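(* Let $\alpha\in(0,2)$, let $\Omega=(a_x,b_x)\times(a_y,b_y)\subset\mathbb{R}^2$ be a bounded rectangle, and let $u:\mathbb{R}^2\to\mathbb{R}$ satisfy $u=0$ on $\mathbb{R}^2\setminus\Omega$. Let $0<\varepsilon\le 1+\lfloor\alpha\rfloor-\alpha$ and assume $u\in C^{\lfloor\alpha\rfloor,\,\alpha-\lfloor\alpha\rfloor+\varepsilon}(\mathbb{R}^2)$. Then for every splitting parameter $\gamma\in(\alpha,2]$ there is a constant $C>0$ independent of $h$ such that, for all sufficiently small $h=L/N$, $$\sup_{\mathbf{x}\in\Omega}\big|(-\Delta)^{\alpha/2}u(\mathbf{x})-(-\Delta)^{\alpha/2}_{h,\gamma}u(\mathbf{x})\big|\le C h^{\varepsilon}.$$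
   Context: $\lfloor\cdot\rfloor$ is the floor function. For $k\in\mathbb{N}_0$, $s\in(0,1]$, $C^{k,s}(\mathbb{R}^d)$ is the space of functions $\mathbb{R}^d\to\mathbb{R}$ with continuous partial derivatives of all orders $\le k$ whose $k$-th order partial derivatives are uniformly Hölder continuous with exponent $s$. The fractional Laplacian is $(-\Delta)^{\alpha/2}u(\mathbf{x})=c_{d,\alpha}\,\mathrm{P.V.}\int_{\mathbb{R}^d}\frac{u(\mathbf{x})-u(\mathbf{x}')}{|\mathbf{x}-\mathbf{x}'|^{d+\alpha}}\,d\mathbf{x}'$ with $c_{d,\alpha}=\frac{2^{\alpha-1}\alpha\,\Gamma((d+\alpha)/2)}{\pi^{d/2}\Gamma(1-\alpha/2)}$. Two-dimensional discrete operator: let $L=\max\{b_x-a_x,b_y-a_y\}$, $N$ a positive integer, $h=L/N$, $\boldsymbol{\xi}_{ij}=(ih,jh)$, $I_{ij}=[ih,(i+1)h]\times[jh,(j+1)h]$, $D_1=(0,L)^2$, $D_2=[0,\infty)^2\setminus D_1$. For $\mathbf{x}=(x,y)$ and $\boldsymbol{\xi}=(\xi,\eta)\in[0,\infty)^2\setminus\{0\}$ set $\psi_\gamma(\mathbf{x},\boldsymbol{\xi})=|\boldsymbol{\xi}|^{-\gamma}\Big(\sum_{m,n\in\{0,1\}}u(x+(-1)^m\xi,\,y+(-1)^n\eta)-4u(\mathbf{x})\Big)$ and $\omega_\gamma(\boldsymbol{\xi})=|\boldsymbol{\xi}|^{\gamma-(2+\alpha)}$. Let $c^\gamma_{mn}=1$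 for $(m,n)\in\{(1,0),(0,1),(1,1)\}$ when $\gamma\in(\alpha,2)$, and $c^2_{10}=c^2_{01}=2$, $c^2_{11}=0$ when $\gamma=2$. Define, for $\mathbf{x}\in\Omega$, $$(-\Delta)^{\alpha/2}_{h,\gamma}u(\mathbf{x})=-c_{2,\alpha}\Big[\tfrac14\Big(\sum_{(m,n)\in\{0,1\}^2\setminus\{(0,0)\}}c^\gamma_{mn}\psi_\gamma(\mathbf{x},\boldsymbol{\xi}_{mn})\Big)\int_{I_{00}}\omega_\gamma\,d\boldsymbol{\xi}+\tfrac14\sum_{\substack{0\le i,j\le N-1\\(i,j)\ne(0,0)}}\Big(\sum_{m,n\in\{0,1\}}\psi_\gamma(\mathbf{x},\boldsymbol{\xi}_{(i+m)(j+n)})\Big)\int_{I_{ij}}\omega_\gamma\,d\boldsymbol{\xi}-4u(\mathbf{x})\int_{D_2}|\boldsymbol{\xi}|^{-(2+\alpha)}d\boldsymbol{\xi}\Big].$$ *)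

theory Defs
  imports "HOL-Analysis.Analysis"
begin

definition dir_deriv :: "(real \<times> real \<Rightarrow> real) \<Rightarrow> real \<times> real \<Rightarrow> (real \<times> real \<Rightarrow> real)" where
  "dir_deriv f e = (\<lambda>x. deriv (\<lambda>t. f (x + t *\<^sub>R e)) 0)"

fun iter_pd :: "(real \<times> real) list \<Rightarrow> (real \<times> real \<Rightarrow> real) \<Rightarrow> (real \<times> real \<Rightarrow> real)" where
  "iter_pd [] f = f"
| "iter_pd (e # es) f = dir_deriv (iter_pd es f) e"

definition holder_space :: "nat \<Rightarrow> real \<Rightarrow> (real \<times> real \<Rightarrow> real) set" where
  "holder_space k s = {u.
     (\<forall>es. set es \<subseteq> Basis \<and> length es < k \<longrightarrow>
        (\<forall>e\<in>Basis. \<forall>x. (\<lambda>t. iter_pd es u (x + t *\<^sub>R e)) differentiable (at 0))) \<and>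
     (\<forall>es. set es \<subseteq> Basis \<and> length es \<le> k \<longrightarrow> continuous_on UNIV (iter_pd es u)) \<and>
     (\<forall>es. set es \<subseteq> Basis \<and> length es = k \<longrightarrow>
        (\<exists>M. \<forall>x y. \<bar>iter_pd es u x - iter_pd es u y\<bar> \<le> M * dist x y powr s))}"

definition frac_const :: "real \<Rightarrow> real \<Rightarrow> real" where
  "frac_const d \<alpha> = 2 powr (\<alpha> - 1) * \<alpha> * Gamma ((d + \<alpha>) / 2)
                      / (pi powr (d / 2) * Gamma (1 - \<alpha> / 2))"

definition frac_lap :: "real \<Rightarrow> (real \<times> real \<Rightarrow> real) \<Rightarrow> real \<times> real \<Rightarrow> real" where
  "frac_lap \<alpha> u x = frac_const 2 \<alpha> *
     Lim (at_right 0) (\<lambda>\<delta>. integral {x'. \<delta> < dist x x'}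
            (\<lambda>x'. (u x - u x') / dist x x' powr (2 + \<alpha>)))"

definition psi :: "real \<Rightarrow> (real \<times> real \<Rightarrow> real) \<Rightarrow> real \<times> real \<Rightarrow> real \<times> real \<Rightarrow> real" where
  "psi \<gamma> u x \<xi> = norm \<xi> powr (-\<gamma>) *
     ((\<Sum>m\<in>{0::nat,1}. \<Sum>n\<in>{0::nat,1}.
         u (fst x + (-1) ^ m * fst \<xi>, snd x + (-1) ^ n * snd \<xi>)) - 4 * u x)"

definition omega :: "real \<Rightarrow> real \<Rightarrow> real \<times> real \<Rightarrow> real" where
  "omega \<alpha> \<gamma> \<xi> = norm \<xi> powr (\<gamma> - (2 + \<alpha>))"

definition coef :: "real \<Rightarrow> nat \<Rightarrow> nat \<Rightarrow> real" where
  "coef \<gamma> m n = (if \<gamma> = 2 then (if m = 1 \<and> n = 1 then 0 else 2) else 1)"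

definition grid_pt :: "real \<Rightarrow> nat \<Rightarrow> nat \<Rightarrow> real \<times> real" where
  "grid_pt h i j = (real i * h, real j * h)"

definition cell :: "real \<Rightarrow> nat \<Rightarrow> nat \<Rightarrow> (real \<times> real) set" where
  "cell h i j = cbox (real i * h, real j * h) (real (i + 1) * h, real (j + 1) * h)"

definition D2 :: "real \<Rightarrow> (real \<times> real) set" where
  "D2 L = {\<xi>. 0 \<le> fst \<xi> \<and> 0 \<le> snd \<xi>} - box (0, 0) (L, L)"

text \<open>The discrete operator with L = max(b_x-a_x, b_y-a_y), h = L/N.\<close>
definition disc_frac_lap :: "real \<Rightarrow> real \<Rightarrow> real \<Rightarrow> nat \<Rightarrow> (real \<times> real \<Rightarrow> real) \<Rightarrow> real \<times> real \<Rightarrow> real" where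
  "disc_frac_lap \<alpha> \<gamma> L N u x =
     (let h = L / real N in
      - frac_const 2 \<alpha> *
      ( 1/4 * (coef \<gamma> 1 0 * psi \<gamma> u x (grid_pt h 1 0)
             + coef \<gamma> 0 1 * psi \<gamma> u x (grid_pt h 0 1)
             + coef \<gamma> 1 1 * psi \<gamma> u x (grid_pt h 1 1))
            * integral (cell h 0 0) (omega \<alpha> \<gamma>)
      + 1/4 * (\<Sum>(i, j) \<in> ({0..<N} \<times> {0..<N}) - {(0, 0)}.
            (\<Sum>m\<in>{0::nat,1}. \<Sum>n\<in>{0::nat,1}. psi \<gamma> u x (grid_pt h (i + m) (j + n)))
            * integral (cell h i j) (omega \<alpha> \<gamma>))
      - 4 * u x * integral (D2 L) (\<lambda>\<xi>. norm \<xi> powr (-(2 + \<alpha>)))))"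

end

theory Submission
  imports Defs
begin

text \<open>Folding the singular integral onto the first quadrant turns it into the integral of
  \<open>\<psi>\<^sub>\<gamma> \<omega>\<^sub>\<gamma>\<close>, where \<open>|\<xi>|\<^sup>\<gamma> \<psi>\<^sub>\<gamma>\<close> is a sum of second differences of \<open>u\<close> and hence
  \<open>O(|\<xi>|\<^bsup>\<alpha>+\<epsilon>\<^esup>)\<close>. On the part \<open>D\<^sub>2\<close> both sides agree exactly, because \<open>u\<close> vanishes at the four shifted points. On the cell at
  the origin both terms are separately \<open>O(h\<^sup>\<epsilon>)\<close>. On the cell with index \<open>(i, j)\<close> put \<open>m = max i j\<close>; the
  mean of the four corner values is exact for affine functions when the weight is constant, and
  symmetrizing about the centre of the cell gives an error \<open>O(h\<^sup>\<epsilon> m\<^bsup>-(2+\<alpha>)\<^esup>)\<close>, which is summable over the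
  grid.\<close>

subsection \<open>Differences of radial powers\<close>

text \<open>Let R be the distance scale of a cell, \<sigma> = \<alpha> + \<epsilon> \<le> 2, and g
  the sum of second differences. Across the cell, up to constants, g is bounded by (R/h)^2
  h^\<sigma>, its first differences by (R/h) h^\<sigma>, and only its second differences by
  h^\<sigma>. A radial power has first and second differences smaller than itself by h/R and
  (h/R)^2. The obstacle is that a first difference of g taken alone loses a factor R/h, which is
  comparable to m. Symmetrization and the discrete product rule let it occur only next to a
  difference of a radial factor, which restores h/R. One cell then contributes h^\<sigma> times
  R^(-\<gamma>) times R^(\<gamma>-2-\<alpha>) times the area h^2, and R = m h turns this into the
  stated size.\<close>

lemma powr_minus_diff_bound:
  fixes R x y b :: real
  assumes "0 < R" "R \<le> x" "R \<le> y" "0 \<le> b"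
  shows "\<bar>x powr (-b) - y powr (-b)\<bar> \<le> b * R powr (-b-1) * \<bar>x - y\<bar>"
proof -
  have "norm (x powr (-b) - y powr (-b)) \<le> b * R powr (-b-1) * norm (x - y)"
  proof (rule field_differentiable_bound[where S="{R..}" and f'="\<lambda>z. (-b) * z powr (-b-1)"])
    fix z assume z: "z \<in> {R..}"
    then have "z > 0" using assms by auto
    then show "((\<lambda>x. x powr (-b)) has_field_derivative (-b) * z powr (-b-1)) (at z within {R..})"
      by (auto intro!: derivative_eq_intros)
    have "z powr (-b-1) \<le> R powr (-b-1)"
      using assms z by (intro powr_mono2') auto
    then show "norm ((-b) * z powr (-b-1)) \<le> b * R powr (-b-1)"
      using assms by (auto simp: abs_mult intro: mult_left_mono)
  qed (use assms in auto)
  then show ?thesis by simp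
qed

text \<open>Adding the tangent term makes the derivative of \<open>?f\<close> vanish at
  \<open>x\<close>. The first-order bound with exponent \<open>b + 1\<close> controls that
  derivative on the segment, and the mean value inequality yields a quadratic remainder without
  Taylor's factor 1/2.\<close>

lemma powr_minus_taylor_bound:
  fixes R x y b :: real
  assumes "0 < R" "R \<le> x" "R \<le> y" "0 \<le> b"
  shows "\<bar>y powr (-b) - x powr (-b) + b * x powr (-b-1) * (y - x)\<bar> \<le> b * (b+1) * R powr (-b-2) * (y - x)\<^sup>2"
proof -
  define B where "B = b * (b+1) * R powr (-b-2) * \<bar>y - x\<bar>"
  let ?f = "\<lambda>z. z powr (-b) + b * x powr (-b-1) * z"
  have "norm (?f y - ?f x) \<le> B * norm (y - x)"
  proof (rule field_differentiable_bound[where S="closed_segment x y" and f'="\<lambda>z. (-b) * z powr (-b-1) + b * x powr (-b-1)"])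
    fix z assume z: "z \<in> closed_segment x y"
    then have zR: "R \<le> z" using assms by (auto simp: closed_segment_eq_real_ivl split: if_splits)
    then have "z > 0" using assms by auto
    then show "(?f has_field_derivative (-b) * z powr (-b-1) + b * x powr (-b-1)) (at z within closed_segment x y)"
      by (auto intro!: derivative_eq_intros)
    have "\<bar>x powr (-(b+1)) - z powr (-(b+1))\<bar> \<le> (b+1) * R powr (-(b+1)-1) * \<bar>x - z\<bar>"
      using assms zR by (intro powr_minus_diff_bound) auto
    also have "\<dots> \<le> (b+1) * R powr (-(b+1)-1) * \<bar>y - x\<bar>"
      using z assms by (intro mult_left_mono) (auto simp: closed_segment_eq_real_ivl split: if_splits)
    finally have *: "\<bar>x powr (-b-1) - z powr (-b-1)\<bar> \<le> (b+1) * R powr (-b-2) * \<bar>y - x\<bar>"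
      by (simp add: diff_diff_eq minus_add_distrib)
    have "norm ((-b) * z powr (-b-1) + b * x powr (-b-1)) = b * \<bar>x powr (-b-1) - z powr (-b-1)\<bar>"
      using assms by (simp add: abs_mult_pos' algebra_simps)
    also have "\<dots> \<le> b * ((b+1) * R powr (-b-2) * \<bar>y - x\<bar>)"
      using * assms by (intro mult_left_mono) auto
    finally show "norm ((-b) * z powr (-b-1) + b * x powr (-b-1)) \<le> B"
      by (simp add: B_def)
  qed auto
  moreover have "B * norm (y - x) = b * (b+1) * R powr (-b-2) * (y - x)\<^sup>2"
    unfolding B_def by (simp add: power2_eq_square mult.assoc)
  moreover have "?f y - ?f x = y powr (-b) - x powr (-b) + b * x powr (-b-1) * (y - x)"
    by (simp add: algebra_simps)
  ultimately show ?thesis by simp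
qed

text \<open>The bound is arranged as the size of the power times the relative displacement
  \<open>d / R\<close>, the ratio that later compensates first differences of
  \<open>g\<close>.\<close>

lemma norm_powr_minus_diff_bound:
  fixes x y :: "'a::real_normed_vector"
  assumes "0 < R" "R \<le> norm x" "R \<le> norm y" "0 \<le> a" "norm (x - y) \<le> d"
  shows "\<bar>norm x powr (-a) - norm y powr (-a)\<bar> \<le> a * R powr (-a) * (d / R)"
proof -
  have "\<bar>norm x powr (-a) - norm y powr (-a)\<bar> \<le> a * R powr (-a-1) * \<bar>norm x - norm y\<bar>"
    using assms by (intro powr_minus_diff_bound) auto
  also have "\<dots> \<le> a * R powr (-a-1) * d"
    using assms norm_triangle_ineq3[of x y] by (intro mult_left_mono) auto
  also have "\<dots> = a * R powr (-a) * (d / R)"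
    using assms by (simp add: powr_diff)
  finally show ?thesis .
qed

text \<open>The squared norm \<open>q\<close> has the exact increments 2 c.v + v.v and -2 c.v + v.v,
  so in the expansion of \<open>q powr (-b)\<close> with \<open>b = a / 2\<close> the linear terms
  cancel up to 2 v.v. What remains are two Taylor remainders in one real variable, and the norm
  itself is never differentiated.\<close>

lemma norm_powr_minus_second_diff_bound:
  fixes c v :: "'a::real_inner"
  assumes R: "0 < R" "R \<le> norm c" "R \<le> norm (c + v)" "R \<le> norm (c - v)" "norm c \<le> 3 * R"
    and h: "norm v \<le> h" "h \<le> R" and a: "0 \<le> a"
  shows "\<bar>norm (c + v) powr (-a) + norm (c - v) powr (-a) - 2 * norm c powr (-a)\<bar>
           \<le> (a + 49 * (a * (a / 2 + 1))) * R powr (-a) * (h / R)\<^sup>2"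
proof -
  define b where "b = a / 2"
  have b: "0 \<le> b" using a by (simp add: b_def)
  have h0: "0 \<le> h" using h norm_ge_zero[of v] by linarith
  define q where "q = (\<lambda>x::'a. (norm x)\<^sup>2)"
  have nq: "norm x powr (-a) = q x powr (-b)" if "R \<le> norm x" for x
  proof -
    have "norm x > 0" using that R by linarith
    then have "q x = norm x powr 2" unfolding q_def by (simp add: powr_numeral)
    then show ?thesis by (simp only: powr_powr) (simp add: b_def)
  qed
  have qR: "R\<^sup>2 \<le> q x" if "R \<le> norm x" for x
    using that R unfolding q_def by (intro power_mono) auto
  have Rp: "(R\<^sup>2) powr (-b-1) = R powr (-a) / R^2" "(R\<^sup>2) powr (-b-2) = R powr (-a) / R^4"
  proof -
    have e: "R\<^sup>2 = R powr 2" "R^4 = R powr 4" using R by (simp_all add: powr_numeral)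
    have "2 * (-b-1) = -a - 2" "2 * (-b-2) = -a - 4" by (simp_all add: b_def)
    then show "(R\<^sup>2) powr (-b-1) = R powr (-a) / R^2" "(R\<^sup>2) powr (-b-2) = R powr (-a) / R^4"
      unfolding e powr_powr by (simp_all only: powr_diff)
  qed
  have cv: "\<bar>c \<bullet> v\<bar> \<le> 3 * R * h"
    using Cauchy_Schwarz_ineq2[of c v] mult_mono[OF R(5) h(1)] R by simp
  have vv: "v \<bullet> v \<le> h\<^sup>2" "v \<bullet> v \<le> R * h" "0 \<le> v \<bullet> v"
    using h h0 by (auto simp: dot_square_norm power2_eq_square intro!: mult_mono)
  have qe: "q (c + v) - q c = 2 * (c \<bullet> v) + v \<bullet> v" "q (c - v) - q c = - 2 * (c \<bullet> v) + v \<bullet> v"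
    unfolding q_def power2_norm_eq_inner
    by (simp_all add: algebra_simps inner_commute)
  \<comment> \<open>The 7 is 2 * 3 + 1: the inner product is at most 3 R h, and h \<le> R gives v.v
    \<le> R h. Its square is the 49 of the statement.\<close>
  have d: "(q (c + v) - q c)\<^sup>2 \<le> (7 * R * h)\<^sup>2" "(q (c - v) - q c)\<^sup>2 \<le> (7 * R * h)\<^sup>2"
  proof -
    have "\<bar>2 * (c \<bullet> v) + v \<bullet> v\<bar> \<le> 7 * (R * h)" "\<bar>- 2 * (c \<bullet> v) + v \<bullet> v\<bar> \<le> 7 * (R * h)"
      using cv vv by linarith+
    then show "(q (c + v) - q c)\<^sup>2 \<le> (7 * R * h)\<^sup>2" "(q (c - v) - q c)\<^sup>2 \<le> (7 * R * h)\<^sup>2"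
      unfolding qe abs_le_square_iff[symmetric] by (simp_all add: mult.assoc)
  qed
  define B where "B = b * (b+1) * (R\<^sup>2) powr (-b-2) * (7 * R * h)\<^sup>2"
  have B: "\<bar>q y powr (-b) - q c powr (-b) + b * q c powr (-b-1) * (q y - q c)\<bar> \<le> B"
    if "R \<le> norm y" "(q y - q c)\<^sup>2 \<le> (7 * R * h)\<^sup>2" for y
  proof -
    have "\<bar>q y powr (-b) - q c powr (-b) + b * q c powr (-b-1) * (q y - q c)\<bar> \<le> b * (b+1) * (R\<^sup>2) powr (-b-2) * (q y - q c)\<^sup>2"
      using R b qR that by (intro powr_minus_taylor_bound) auto
    also have "\<dots> \<le> B" unfolding B_def using b that by (intro mult_left_mono) auto
    finally show ?thesis .
  qed
  have l: "\<bar>b * q c powr (-b-1) * (2 * (v \<bullet> v))\<bar> \<le> b * (R\<^sup>2) powr (-b-1) * (2 * h\<^sup>2)"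
  proof -
    have "q c powr (-b-1) \<le> (R\<^sup>2) powr (-b-1)"
      using qR[OF R(2)] R b by (intro powr_mono2') auto
    then show ?thesis using b vv
      by (simp add: abs_mult) (intro mult_mono, auto)
  qed
  have "q (c + v) powr (-b) + q (c - v) powr (-b) - 2 * q c powr (-b)
     = (q (c + v) powr (-b) - q c powr (-b) + b * q c powr (-b-1) * (q (c + v) - q c))
     + (q (c - v) powr (-b) - q c powr (-b) + b * q c powr (-b-1) * (q (c - v) - q c))
     - b * q c powr (-b-1) * (2 * (v \<bullet> v))"
    unfolding qe by (simp add: algebra_simps)
  then have "\<bar>q (c + v) powr (-b) + q (c - v) powr (-b) - 2 * q c powr (-b)\<bar>
     \<le> 2 * B + b * (R\<^sup>2) powr (-b-1) * (2 * h\<^sup>2)"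
    using B[OF R(3) d(1)] B[OF R(4) d(2)] l by linarith
  also have "\<dots> = (a + 49 * (a * (a / 2 + 1))) * R powr (-a) * (h / R)\<^sup>2"
    unfolding B_def Rp using R by (simp add: b_def field_simps power2_eq_square power4_eq_xxxx)
  finally show ?thesis using nq[OF R(2)] nq[OF R(3)] nq[OF R(4)] by simp
qed

subsection \<open>Quadrature error on a cell away from the origin\<close>

text \<open>\<open>A\<close> is the scale of a second difference of \<open>P\<close>. A first
  difference may be larger by R/h, so the second claim carries the factor \<open>h / R\<close>,
  which a difference of the quadrature weight will supply.\<close>

lemma cell_second_order_bounds:
  fixes g :: "'a::real_inner \<Rightarrow> real" and h R K \<sigma> \<gamma> :: real
  defines "P \<equiv> (\<lambda>\<xi>. norm \<xi> powr (-\<gamma>) * g \<xi>)"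
    and "A \<equiv> K * h powr \<sigma> * R powr (-\<gamma>)"
  assumes h: "0 < h" "h \<le> R" and K: "0 \<le> K" and \<gamma>: "0 \<le> \<gamma>" and \<sigma>: "0 \<le> \<sigma>" "\<sigma> \<le> 2"
    and g1: "\<And>\<xi>. \<bar>g \<xi>\<bar> \<le> K * norm \<xi> powr \<sigma>"
    and g2: "\<And>\<xi> \<xi>' d r. 0 < d \<Longrightarrow> d \<le> r \<Longrightarrow> norm \<xi> \<le> r \<Longrightarrow> norm \<xi>' \<le> r \<Longrightarrow> norm (\<xi> - \<xi>') \<le> d
               \<Longrightarrow> d * \<bar>g \<xi> - g \<xi>'\<bar> \<le> K * d powr \<sigma> * r"
    and g3: "\<And>c v d. 0 < d \<Longrightarrow> norm v \<le> d \<Longrightarrow> \<bar>g (c + v) + g (c - v) - 2 * g c\<bar> \<le> K * d powr \<sigma>"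
    and c: "R \<le> norm c" "norm c \<le> 3 * R"
  shows "norm v \<le> h \<Longrightarrow> R \<le> norm (c + v) \<Longrightarrow> R \<le> norm (c - v) \<Longrightarrow>
           \<bar>P (c + v) + P (c - v) - 2 * P c\<bar> \<le> (1 + 8 * \<gamma> + 16 * (\<gamma> + 49 * (\<gamma> * (\<gamma> / 2 + 1)))) * A"
    and "norm v \<le> h \<Longrightarrow> norm w \<le> h \<Longrightarrow> R \<le> norm (c + v) \<Longrightarrow> R \<le> norm (c + w) \<Longrightarrow>
           \<bar>P (c + v) - P (c + w)\<bar> * (h / R) \<le> (8 + 32 * \<gamma>) * A"
proof -
  define \<rho> where "\<rho> = (\<lambda>\<xi>::'a. norm \<xi> powr (-\<gamma>))"
  define B where "B = R powr (-\<gamma>)"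
  have R: "0 < R" using h by linarith
  have AB: "A = K * h powr \<sigma> * B" by (simp add: A_def B_def)
  have B0: "0 \<le> B" "0 \<le> K * h powr \<sigma>" using K by (simp_all add: B_def)
  have \<rho>: "\<bar>\<rho> x\<bar> \<le> B" if "R \<le> norm x" for x
    unfolding \<rho>_def B_def using that R \<gamma> by (auto intro!: powr_mono2')
  have four: "2 powr \<sigma> \<le> 4" "4 powr \<sigma> \<le> (16::real)"
    using \<sigma> powr_mono[of \<sigma> 2 2] powr_mono[of \<sigma> 2 4] by (auto simp: powr_numeral)
  \<comment> \<open>The two points are within 2 h of each other and within 4 R of the origin. With
    \<open>2 powr \<sigma> \<le> 4\<close> the constant is 4 * 4 / 2 = 8.\<close>
  have gd: "h / R * \<bar>g (c + v) - g (c + w)\<bar> \<le> 8 * (K * h powr \<sigma>)" if "norm v \<le> h" "norm w \<le> h" for v w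
  proof -
    have "(2 * h) * \<bar>g (c + v) - g (c + w)\<bar> \<le> K * (2 * h) powr \<sigma> * (4 * R)"
      using that h c norm_triangle_ineq[of c v] norm_triangle_ineq[of c w] norm_triangle_ineq4[of v w]
      by (intro g2) auto
    also have "\<dots> \<le> K * (4 * h powr \<sigma>) * (4 * R)"
      using four h K by (intro mult_right_mono mult_left_mono) (auto simp: powr_mult)
    finally show ?thesis using R by (simp add: field_simps)
  qed
  have gs: "(h / R)\<^sup>2 * \<bar>g (c + v)\<bar> \<le> 16 * (K * h powr \<sigma>)" if "norm v \<le> h" for v
  proof -
    have "\<bar>g (c + v)\<bar> \<le> K * norm (c + v) powr \<sigma>" by (rule g1)
    also have "\<dots> \<le> K * (4 * R) powr \<sigma>"
      using that h c norm_triangle_ineq[of c v] K \<sigma> by (intro mult_left_mono powr_mono2) auto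
    also have "\<dots> \<le> K * (16 * R powr \<sigma>)"
      using four R K by (intro mult_left_mono) (auto simp: powr_mult)
    finally have *: "\<bar>g (c + v)\<bar> \<le> K * (16 * R powr \<sigma>)" .
    \<comment> \<open>As h \<le> R and \<sigma> \<le> 2, the square of h / R absorbs the \<sigma>
      powers of R / h by which the size of \<open>g\<close> exceeds K h^\<sigma>.\<close>
    have "(h / R)\<^sup>2 = (h / R) powr 2" using h R by (simp add: powr_numeral)
    also have "\<dots> \<le> (h / R) powr \<sigma>" using h R \<sigma> by (intro powr_mono') auto
    also have "\<dots> = h powr \<sigma> / R powr \<sigma>" using h R by (simp add: powr_divide)
    finally have "(h / R)\<^sup>2 * \<bar>g (c + v)\<bar> \<le> (h powr \<sigma> / R powr \<sigma>) * (K * (16 * R powr \<sigma>))"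
      using * by (intro mult_mono) auto
    then show ?thesis using R by (simp add: mult_ac)
  qed
  {
    assume v: "norm v \<le> h" "R \<le> norm (c + v)" "R \<le> norm (c - v)"
    have a1: "\<bar>\<rho> c * (g (c + v) + g (c - v) - 2 * g c)\<bar> \<le> B * (K * h powr \<sigma>)"
      unfolding abs_mult using \<rho>[OF c(1)] g3[OF h(1) v(1)] B0 by (intro mult_mono) auto
    have "\<bar>\<rho> (c + v) - \<rho> c\<bar> \<le> \<gamma> * B * (h / R)"
      unfolding \<rho>_def B_def using R c v \<gamma> by (intro norm_powr_minus_diff_bound) auto
    then have "\<bar>(\<rho> (c + v) - \<rho> c) * (g (c + v) - g (c - v))\<bar> \<le> (\<gamma> * B * (h / R)) * \<bar>g (c + v) - g (c + - v)\<bar>"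
      unfolding abs_mult by (intro mult_mono) auto
    also have "\<dots> = \<gamma> * B * (h / R * \<bar>g (c + v) - g (c + - v)\<bar>)" by simp
    also have "\<dots> \<le> \<gamma> * B * (8 * (K * h powr \<sigma>))"
      using \<gamma> B0 v by (intro mult_left_mono gd) auto
    finally have a2: "\<bar>(\<rho> (c + v) - \<rho> c) * (g (c + v) - g (c - v))\<bar> \<le> \<gamma> * B * (8 * (K * h powr \<sigma>))" .
    let ?C = "\<gamma> + 49 * (\<gamma> * (\<gamma> / 2 + 1))"
    have "\<bar>\<rho> (c + v) + \<rho> (c - v) - 2 * \<rho> c\<bar> \<le> ?C * B * (h / R)\<^sup>2"
      unfolding \<rho>_def B_def using R c v h \<gamma> by (intro norm_powr_minus_second_diff_bound) auto
    then have "\<bar>(\<rho> (c + v) + \<rho> (c - v) - 2 * \<rho> c) * g (c - v)\<bar> \<le> (?C * B * (h / R)\<^sup>2) * \<bar>g (c + - v)\<bar>"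
      unfolding abs_mult by (intro mult_mono) auto
    also have "\<dots> = ?C * B * ((h / R)\<^sup>2 * \<bar>g (c + - v)\<bar>)" by simp
    also have "\<dots> \<le> ?C * B * (16 * (K * h powr \<sigma>))"
      using \<gamma> B0 v by (intro mult_left_mono gs) auto
    finally have a3: "\<bar>(\<rho> (c + v) + \<rho> (c - v) - 2 * \<rho> c) * g (c - v)\<bar> \<le> ?C * B * (16 * (K * h powr \<sigma>))" .
    \<comment> \<open>Discrete Leibniz rule: each difference of \<open>g\<close> is multiplied by a
      difference of the radial factor of complementary order, the total order being two.\<close>
    have "P (c + v) + P (c - v) - 2 * P c = \<rho> c * (g (c + v) + g (c - v) - 2 * g c)
        + (\<rho> (c + v) - \<rho> c) * (g (c + v) - g (c - v))
        + (\<rho> (c + v) + \<rho> (c - v) - 2 * \<rho> c) * g (c - v)"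
      unfolding P_def \<rho>_def by (simp add: algebra_simps)
    then have "\<bar>P (c + v) + P (c - v) - 2 * P c\<bar>
       \<le> B * (K * h powr \<sigma>) + \<gamma> * B * (8 * (K * h powr \<sigma>)) + ?C * B * (16 * (K * h powr \<sigma>))"
      using a1 a2 a3 by linarith
    also have "\<dots> = (1 + 8 * \<gamma> + 16 * ?C) * A" unfolding AB by (simp add: algebra_simps)
    finally show "\<bar>P (c + v) + P (c - v) - 2 * P c\<bar> \<le> (1 + 8 * \<gamma> + 16 * ?C) * A" .
  }
  {
    assume v: "norm v \<le> h" "norm w \<le> h" "R \<le> norm (c + v)" "R \<le> norm (c + w)"
    have "\<bar>\<rho> (c + v) * (g (c + v) - g (c + w))\<bar> \<le> B * \<bar>g (c + v) - g (c + w)\<bar>"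
      unfolding abs_mult using \<rho>[OF v(3)] by (intro mult_right_mono) auto
    moreover have "norm ((c + v) - (c + w)) \<le> 2 * h"
      using v norm_triangle_ineq4[of v w] by simp
    then have "\<bar>\<rho> (c + v) - \<rho> (c + w)\<bar> \<le> \<gamma> * B * (2 * h / R)"
      unfolding \<rho>_def B_def using R v \<gamma> by (intro norm_powr_minus_diff_bound) auto
    then have "\<bar>(\<rho> (c + v) - \<rho> (c + w)) * g (c + w)\<bar> \<le> \<gamma> * B * (2 * h / R) * \<bar>g (c + w)\<bar>"
      unfolding abs_mult by (intro mult_right_mono) auto
    moreover have "P (c + v) - P (c + w) = \<rho> (c + v) * (g (c + v) - g (c + w)) + (\<rho> (c + v) - \<rho> (c + w)) * g (c + w)"
      unfolding P_def \<rho>_def by (simp add: algebra_simps)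
    ultimately have "\<bar>P (c + v) - P (c + w)\<bar> \<le> B * \<bar>g (c + v) - g (c + w)\<bar> + \<gamma> * B * (2 * h / R) * \<bar>g (c + w)\<bar>"
      by linarith
    then have "\<bar>P (c + v) - P (c + w)\<bar> * (h / R)
        \<le> (B * \<bar>g (c + v) - g (c + w)\<bar> + \<gamma> * B * (2 * h / R) * \<bar>g (c + w)\<bar>) * (h / R)"
      using h R by (intro mult_right_mono) auto
    also have "\<dots> = B * (h / R * \<bar>g (c + v) - g (c + w)\<bar>) + 2 * \<gamma> * B * ((h / R)\<^sup>2 * \<bar>g (c + w)\<bar>)"
      by (simp add: algebra_simps power2_eq_square)
    also have "\<dots> \<le> B * (8 * (K * h powr \<sigma>)) + 2 * \<gamma> * B * (16 * (K * h powr \<sigma>))"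
      using \<gamma> B0 v by (intro add_mono mult_left_mono gs gd) auto
    also have "\<dots> = (8 + 32 * \<gamma>) * A" unfolding AB by (simp add: algebra_simps)
    finally show "\<bar>P (c + v) - P (c + w)\<bar> * (h / R) \<le> (8 + 32 * \<gamma>) * A" .
  }
qed

section \<open>Reflection of a box in its centre\<close>

lemma integral_cbox_point_reflection:
  fixes f :: "'a::euclidean_space \<Rightarrow> real"
  assumes "f integrable_on cbox a b" "cbox a b \<noteq> {}"
  shows "((\<lambda>x. f (a + b - x)) has_integral integral (cbox a b) f) (cbox a b)"
proof -
  have "((\<lambda>x. f ((-1) *\<^sub>R x + (a + b))) has_integral (1 / \<bar>-1\<bar> ^ DIM('a)) *\<^sub>R integral (cbox a b) f)
          ((\<lambda>x. (1 / -1) *\<^sub>R x + -((1 / -1) *\<^sub>R (a + b))) ` cbox a b)"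
    using assms by (intro has_integral_affinity integrable_integral) auto
  moreover have "(\<lambda>x. (1 / -1) *\<^sub>R x + -((1 / -1) *\<^sub>R (a + b))) ` cbox a b = cbox a b"
    using assms by (subst image_affinity_cbox) (auto simp: algebra_simps)
  ultimately show ?thesis by (simp add: algebra_simps)
qed

text \<open>Averaging the integrand over the reflection of the box in its centre cancels its first-order part.\<close>

lemma integral_cbox_symmetrized_bound:
  fixes f w :: "'a::euclidean_space \<Rightarrow> real"
  assumes cont: "continuous_on (cbox a b) f" "continuous_on (cbox a b) w" and ne: "cbox a b \<noteq> {}"
    and A1: "\<And>x. x \<in> cbox a b \<Longrightarrow> \<bar>f x + f (a + b - x)\<bar> \<le> A1"
    and W: "\<And>x. x \<in> cbox a b \<Longrightarrow> \<bar>w x\<bar> \<le> W"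
    and A2: "\<And>x. x \<in> cbox a b \<Longrightarrow> \<bar>f x\<bar> * \<bar>w x - w (a + b - x)\<bar> \<le> A2"
  shows "\<bar>integral (cbox a b) (\<lambda>x. f x * w x)\<bar> \<le> (A1 * W + A2) / 2 * measure lborel (cbox a b)"
proof -
  let ?I = "integral (cbox a b) (\<lambda>x. f x * w x)"
  have int: "(\<lambda>x. f x * w x) integrable_on cbox a b"
    using cont by (intro integrable_continuous continuous_intros)
  have refl: "a + b - x \<in> cbox a b" if "x \<in> cbox a b" for x
    using that by (auto simp: mem_box algebra_simps)
  obtain z where z: "z \<in> cbox a b" using ne by auto
  have nn: "0 \<le> A1" "0 \<le> W" "0 \<le> A2"
    using order_trans[OF abs_ge_zero A1[OF z]] order_trans[OF abs_ge_zero W[OF z]]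
      order_trans[OF mult_nonneg_nonneg[OF abs_ge_zero abs_ge_zero] A2[OF z]] .
  have "((\<lambda>x. f x * w x + f (a + b - x) * w (a + b - x)) has_integral (?I + ?I)) (cbox a b)"
    using integral_cbox_point_reflection[OF int ne] int by (intro has_integral_add integrable_integral) auto
  moreover have "norm (f x * w x + f (a + b - x) * w (a + b - x)) \<le> A1 * W + A2" if x: "x \<in> cbox a b" for x
  proof -
    let ?y = "a + b - x"
    \<comment> \<open>The weight need not be symmetric, so besides the symmetrized \<open>f\<close>
      there is a term in which \<open>f\<close> alone meets the variation of \<open>w\<close>
      between mirror points.\<close>
    have "f x * w x + f ?y * w ?y = (f x + f ?y) * w x + f ?y * (w ?y - w x)"
      by (simp add: algebra_simps)
    moreover have "\<bar>(f x + f ?y) * w x\<bar> \<le> A1 * W"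
      unfolding abs_mult using A1[OF x] W[OF x] nn by (intro mult_mono) auto
    moreover have "\<bar>f ?y * (w ?y - w x)\<bar> \<le> A2"
      using A2[OF refl[OF x]] by (simp add: abs_mult)
    ultimately show ?thesis unfolding real_norm_def by linarith
  qed
  ultimately have "norm (?I + ?I) \<le> (A1 * W + A2) * measure lborel (cbox a b)"
    using nn by (intro has_integral_bound) auto
  then show ?thesis by simp
qed

section \<open>Cells of the mesh and their quadrature error\<close>

lemma norm_Pair_le_sum: "norm (a, b) \<le> \<bar>a\<bar> + \<bar>b\<bar>" for a b :: real
  using norm_Pair_le[of a b] by simp

lemma norm_Pair_ge: "\<bar>fst \<xi>\<bar> \<le> norm \<xi>" "\<bar>snd \<xi>\<bar> \<le> norm \<xi>" for \<xi> :: "real \<times> real"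
  using norm_fst_le[of "fst \<xi>" "snd \<xi>"] norm_snd_le[of "snd \<xi>" "fst \<xi>"] by simp_all

lemma mem_cell:
  "\<xi> \<in> cell h i j \<longleftrightarrow> real i * h \<le> fst \<xi> \<and> fst \<xi> \<le> real (i + 1) * h \<and> real j * h \<le> snd \<xi> \<and> snd \<xi> \<le> real (j + 1) * h"
  unfolding cell_def by (cases \<xi>) (auto simp: cbox_Pair_eq)

lemma norm_cell_ge:
  assumes "\<xi> \<in> cell h i j" "0 \<le> h"
  shows "real (max i j) * h \<le> norm \<xi>"
  using assms norm_Pair_ge[of \<xi>] by (auto simp: mem_cell max_def)

lemma measure_cell: "0 \<le> h \<Longrightarrow> measure lborel (cell h i j) = h\<^sup>2"
  unfolding cell_def
  by (subst content_Pair) (simp add: algebra_simps power2_eq_square)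

text \<open>The error is the integral of \<open>P\<close> minus its corner mean against the weight,
  a radial power with exponent -(2 + \<alpha> - \<gamma>) \<le> 0. The exponents of R from
  \<open>P\<close> and from the weight add up to -(2 + \<alpha>) for every \<gamma>, which explains
  the power of \<open>max i j\<close>.\<close>

lemma cell_quadrature_error:
  fixes g :: "real \<times> real \<Rightarrow> real" and h K \<alpha> \<sigma> \<gamma> :: real and i j :: nat
  defines "P \<equiv> (\<lambda>\<xi>. norm \<xi> powr (-\<gamma>) * g \<xi>)"
  assumes h: "0 < h" and K: "0 \<le> K" and \<gamma>: "0 \<le> \<gamma>" "\<gamma> \<le> 2 + \<alpha>" and \<sigma>: "0 \<le> \<sigma>" "\<sigma> \<le> 2"
    and ij: "(i, j) \<noteq> (0, 0)"
    and cont: "continuous_on UNIV g"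
    and g1: "\<And>\<xi>. \<bar>g \<xi>\<bar> \<le> K * norm \<xi> powr \<sigma>"
    and g2: "\<And>\<xi> \<xi>' d r. 0 < d \<Longrightarrow> d \<le> r \<Longrightarrow> norm \<xi> \<le> r \<Longrightarrow> norm \<xi>' \<le> r \<Longrightarrow> norm (\<xi> - \<xi>') \<le> d
               \<Longrightarrow> d * \<bar>g \<xi> - g \<xi>'\<bar> \<le> K * d powr \<sigma> * r"
    and g3: "\<And>c v d. 0 < d \<Longrightarrow> norm v \<le> d \<Longrightarrow> \<bar>g (c + v) + g (c - v) - 2 * g c\<bar> \<le> K * d powr \<sigma>"
  shows "\<bar>integral (cell h i j) (\<lambda>\<xi>. P \<xi> * omega \<alpha> \<gamma> \<xi>)
      - 1/4 * (\<Sum>m\<in>{0::nat,1}. \<Sum>n\<in>{0::nat,1}. P (grid_pt h (i + m) (j + n))) * integral (cell h i j) (omega \<alpha> \<gamma>)\<bar>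
    \<le> ((1 + 8 * \<gamma> + 16 * (\<gamma> + 49 * (\<gamma> * (\<gamma> / 2 + 1)))) + (2 + \<alpha> - \<gamma>) * (8 + 32 * \<gamma>))
       * K * h powr (\<sigma> - \<alpha>) * real (max i j) powr (-(2 + \<alpha>))"
    (is "_ \<le> (?C1 + ?\<kappa> * ?C2) * K * _ * _")
proof -
  define C1 where "C1 = ?C1"
  define C2 where "C2 = ?C2"
  define m where "m = real (max i j)"
  define R where "R = m * h"
  define A where "A = K * h powr \<sigma> * R powr (-\<gamma>)"
  define c where "c = ((real i + 1/2) * h, (real j + 1/2) * h)"
  define a where "a = (real i * h, real j * h)"
  define b where "b = (real (i + 1) * h, real (j + 1) * h)"
  define w where "w = omega \<alpha> \<gamma>"
  define S where "S = (\<Sum>m\<in>{0::nat,1}. \<Sum>n\<in>{0::nat,1}. P (grid_pt h (i + m) (j + n)))"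
  have cell: "cell h i j = cbox a b" by (simp add: cell_def a_def b_def)
  have m1: "1 \<le> m" using ij unfolding m_def by (auto simp: max_def)
  have R: "0 < R" "h \<le> R" using h m1 by (simp_all add: R_def)
  have ab: "a + b - (c + v) = c - v" for v
    unfolding a_def b_def c_def by (cases v) (simp add: algebra_simps)
  have c_in: "c \<in> cell h i j" using h by (simp add: c_def mem_cell)
  have Rn: "R \<le> norm \<xi>" if "\<xi> \<in> cell h i j" for \<xi>
    using norm_cell_ge[OF that] h by (simp add: R_def m_def)
  \<comment> \<open>The coordinates of the centre add up to (i + j + 1) h \<le> (2 m + 1) h, and
    \<open>1 \<le> m\<close> makes this at most 3 R.\<close>
  have c3: "norm c \<le> 3 * R"
  proof -
    have "real i \<le> m" "real j \<le> m" by (simp_all add: m_def)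
    then have "(real i + 1/2) * h + (real j + 1/2) * h \<le> (3 * m) * h"
      unfolding distrib_right[symmetric] using h m1 by (intro mult_right_mono) auto
    then show ?thesis
      using norm_Pair_le_sum[of "(real i + 1/2) * h" "(real j + 1/2) * h"] h by (simp add: c_def R_def)
  qed
  have vh: "norm v \<le> h" if "c + v \<in> cell h i j" for v
  proof -
    have "\<bar>fst v\<bar> \<le> h / 2" "\<bar>snd v\<bar> \<le> h / 2"
      using that by (auto simp: mem_cell c_def algebra_simps abs_le_iff)
    then show ?thesis using norm_Pair_le_sum[of "fst v" "snd v"] by simp
  qed
  have cv: "c - v \<in> cell h i j" if "c + v \<in> cell h i j" for v
    using that by (auto simp: mem_cell c_def algebra_simps)
  have second: "\<bar>P (c + v) + P (c - v) - 2 * P c\<bar> \<le> C1 * A" if "c + v \<in> cell h i j" for v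
    unfolding P_def A_def C1_def C2_def
    using that by (intro cell_second_order_bounds(1)[OF h R(2) K \<gamma>(1) \<sigma> g1 g2 g3 Rn[OF c_in] c3] vh Rn cv)
  have first: "\<bar>P (c + v) - P (c + w)\<bar> * (h / R) \<le> C2 * A"
    if "c + v \<in> cell h i j" "c + w \<in> cell h i j" for v w
    unfolding P_def A_def C1_def C2_def
    using that by (intro cell_second_order_bounds(2)[OF h R(2) K \<gamma>(1) \<sigma> g1 g2 g3 Rn[OF c_in] c3] vh Rn)
  \<comment> \<open>\<open>v1\<close> and \<open>v2\<close> are the half diagonals, so the corner
    sum consists of two pairs of points that are mirror images about \<open>c\<close>.\<close>
  define v1 where "v1 = (h/2, h/2)"
  define v2 where "v2 = (h/2, -h/2)"
  have v_in: "c + v1 \<in> cell h i j" "c + v2 \<in> cell h i j" "c + (- v1) \<in> cell h i j" "c + (- v2) \<in> cell h i j"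
    using h by (simp_all add: mem_cell c_def v1_def v2_def algebra_simps)
  have corners: "grid_pt h i j = c - v1" "grid_pt h (i + 1) (j + 1) = c + v1"
      "grid_pt h (i + 1) j = c + v2" "grid_pt h i (j + 1) = c - v2"
    by (simp_all add: grid_pt_def c_def v1_def v2_def algebra_simps)
  have S: "S = P (c - v1) + P (c + v1) + P (c - v2) + P (c + v2)"
    using corners by (simp add: S_def)
  have A0: "0 \<le> A" using K by (simp add: A_def)
  have \<kappa>: "0 \<le> ?\<kappa>" using \<gamma> by simp
  have w: "w x = norm x powr (- ?\<kappa>)" for x by (simp add: w_def omega_def)
  have cn: "continuous_on (cbox a b) (\<lambda>x. norm x powr p)" for p
    using Rn R unfolding cell[symmetric] by (intro continuous_intros) fastforce+
  have "\<bar>integral (cbox a b) (\<lambda>x. (P x - S / 4) * w x)\<bar>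
      \<le> ((2 * C1 * A) * R powr (-?\<kappa>) + 2 * ?\<kappa> * R powr (- ?\<kappa>) * (C2 * A)) / 2 * measure lborel (cbox a b)"
  proof (rule integral_cbox_symmetrized_bound)
    show "continuous_on (cbox a b) (\<lambda>x. P x - S / 4)"
      unfolding P_def using cont
      by (intro continuous_on_diff continuous_on_mult cn continuous_on_const) (auto intro: continuous_on_subset)
    show "continuous_on (cbox a b) w"
      unfolding w[abs_def] by (rule cn)
    show "cbox a b \<noteq> {}" using c_in cell by auto
  next
    fix x assume "x \<in> cbox a b"
    define v where "v = x - c"
    have v: "x = c + v" "c + v \<in> cell h i j" "c - v \<in> cell h i j"
      using cv[of v] \<open>x \<in> cbox a b\<close> by (simp_all add: v_def cell)
    show "\<bar>P x - S / 4 + (P (a + b - x) - S / 4)\<bar> \<le> 2 * C1 * A"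
    proof -
      \<comment> \<open>\<open>P c\<close> cancels, leaving second differences about one common
        centre with weights 1, 1/2, 1/2; hence the factor 2.\<close>
      have "P x - S / 4 + (P (a + b - x) - S / 4) = (P (c + v) + P (c - v) - 2 * P c)
          - ((P (c + v1) + P (c - v1) - 2 * P c) + (P (c + v2) + P (c - v2) - 2 * P c)) / 2"
        unfolding v(1) ab S by (simp add: field_simps)
      moreover have "\<bar>e - (e1 + e2) / 2\<bar> \<le> 2 * B" if "\<bar>e\<bar> \<le> B" "\<bar>e1\<bar> \<le> B" "\<bar>e2\<bar> \<le> B" for e e1 e2 B :: real
        using that unfolding add_divide_distrib by linarith
      ultimately show ?thesis
        using second[OF v(2)] second[OF v_in(1)] second[OF v_in(2)] by (simp only: mult.assoc)
    qed
    show "\<bar>w x\<bar> \<le> R powr (- ?\<kappa>)"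
      unfolding w v(1) using Rn[OF v(2)] R \<kappa> by (auto intro!: powr_mono2')
    \<comment> \<open>Without symmetrization the deviation is only an average of four first
      differences, so it is bounded after multiplication by \<open>h / R\<close>.\<close>
    have "4 * (P x - S / 4) = (P (c + v) - P (c + v1)) + (P (c + v) - P (c + v2))
        + (P (c + v) - P (c + - v1)) + (P (c + v) - P (c + - v2))"
      unfolding S v(1) by (simp add: field_simps)
    then have "(4 * \<bar>P x - S / 4\<bar>) \<le> \<bar>P (c + v) - P (c + v1)\<bar> + \<bar>P (c + v) - P (c + v2)\<bar>
        + \<bar>P (c + v) - P (c + - v1)\<bar> + \<bar>P (c + v) - P (c + - v2)\<bar>"
      by linarith
    then have "(4 * \<bar>P x - S / 4\<bar>) * (h / R) \<le> (\<bar>P (c + v) - P (c + v1)\<bar> + \<bar>P (c + v) - P (c + v2)\<bar>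
        + \<bar>P (c + v) - P (c + - v1)\<bar> + \<bar>P (c + v) - P (c + - v2)\<bar>) * (h / R)"
      using h R by (intro mult_right_mono) auto
    also have "\<dots> \<le> 4 * (C2 * A)"
      unfolding distrib_right
      using first[OF v(2) v_in(1)] first[OF v(2) v_in(2)] first[OF v(2) v_in(3)] first[OF v(2) v_in(4)]
      by linarith
    finally have *: "\<bar>P x - S / 4\<bar> * (h / R) \<le> C2 * A" by simp
    have "norm ((c + v) - (c - v)) \<le> 2 * h"
      using vh[OF v(2)] norm_triangle_ineq[of v v] by simp
    then have "\<bar>w x - w (a + b - x)\<bar> \<le> ?\<kappa> * R powr (- ?\<kappa>) * (2 * h / R)"
      unfolding w v(1) ab using Rn v R \<kappa> by (intro norm_powr_minus_diff_bound) auto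
    then have "\<bar>P x - S / 4\<bar> * \<bar>w x - w (a + b - x)\<bar> \<le> \<bar>P x - S / 4\<bar> * (?\<kappa> * R powr (- ?\<kappa>) * (2 * h / R))"
      by (intro mult_left_mono) auto
    also have "\<dots> = 2 * ?\<kappa> * R powr (- ?\<kappa>) * (\<bar>P x - S / 4\<bar> * (h / R))" by simp
    also have "\<dots> \<le> 2 * ?\<kappa> * R powr (- ?\<kappa>) * (C2 * A)"
      using * \<kappa> by (intro mult_left_mono) auto
    finally show "\<bar>P x - S / 4\<bar> * \<bar>w x - w (a + b - x)\<bar> \<le> 2 * ?\<kappa> * R powr (- ?\<kappa>) * (C2 * A)" .
  qed
  also have "\<dots> = (C1 + ?\<kappa> * C2) * (A * R powr (- ?\<kappa>) * h\<^sup>2)"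
  proof -
    have "((2 * C1 * A) * X + 2 * k * X * (C2 * A)) / 2 * Y = (C1 + k * C2) * (A * X * Y)" for X Y k
      by (simp add: field_simps)
    moreover have "measure lborel (cbox a b) = h\<^sup>2"
      using measure_cell[of h i j] h cell by simp
    ultimately show ?thesis by presburger
  qed
  also have "A * R powr (- ?\<kappa>) * h\<^sup>2 = K * h powr (\<sigma> - \<alpha>) * m powr (-(2 + \<alpha>))"
  proof -
    have "R powr (-\<gamma>) * R powr (- ?\<kappa>) = R powr (-(2 + \<alpha>))"
      unfolding powr_add[symmetric] by simp
    also have "\<dots> = m powr (-(2 + \<alpha>)) * h powr (-(2 + \<alpha>))"
      unfolding R_def using m1 h by (simp add: powr_mult)
    finally have "A * R powr (- ?\<kappa>) * h\<^sup>2 = K * m powr (-(2 + \<alpha>)) * (h powr \<sigma> * h powr (-(2 + \<alpha>)) * h powr 2)"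
      using h by (simp add: A_def powr_numeral)
    also have "h powr \<sigma> * h powr (-(2 + \<alpha>)) * h powr 2 = h powr (\<sigma> - \<alpha>)"
      unfolding powr_add[symmetric] by simp
    finally show ?thesis by simp
  qed
  also have "integral (cbox a b) (\<lambda>x. (P x - S / 4) * w x)
      = integral (cbox a b) (\<lambda>x. P x * w x) - S / 4 * integral (cbox a b) w"
  proof -
    have i: "(\<lambda>x. P x * w x) integrable_on cbox a b" "w integrable_on cbox a b"
      unfolding P_def w[abs_def] using cont
      by (auto intro!: integrable_continuous continuous_on_mult cn intro: continuous_on_subset)
    show ?thesis
      using has_integral_diff[OF integrable_integral[OF i(1)] has_integral_mult_right[OF integrable_integral[OF i(2)], of "S / 4"]]
      by (intro integral_unique) (simp add: left_diff_distrib)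
  qed
  finally show ?thesis unfolding C1_def[symmetric] C2_def[symmetric] S_def[symmetric] w_def[symmetric] cell m_def
    by (simp add: mult.assoc)
qed

subsection \<open>Regularity of even parts\<close>

text \<open>A scale-invariant form of second-order regularity of exponent \<open>\<sigma> \<le> 2\<close>; it covers Hoelder functions
  (\<open>\<sigma> \<le> 1\<close>) and functions with Hoelder continuous gradient (\<open>\<sigma> > 1\<close>) uniformly.\<close>

definition even_part_bound :: "real \<Rightarrow> real \<Rightarrow> ('a::real_normed_vector \<Rightarrow> real) \<Rightarrow> bool" where
  "even_part_bound K \<sigma> u \<longleftrightarrow> (\<forall>p \<xi> \<xi>' d r. 0 < d \<longrightarrow> d \<le> r \<longrightarrow> norm \<xi> \<le> r \<longrightarrow> norm \<xi>' \<le> r \<longrightarrow> norm (\<xi> - \<xi>') \<le> d \<longrightarrow>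
     d * \<bar>(u (p + \<xi>) + u (p - \<xi>)) - (u (p + \<xi>') + u (p - \<xi>'))\<bar> \<le> K * d powr \<sigma> * r)"

lemma even_part_boundD:
  assumes "even_part_bound K \<sigma> u" "0 < d" "d \<le> r" "norm \<xi> \<le> r" "norm \<xi>' \<le> r" "norm (\<xi> - \<xi>') \<le> d"
  shows "d * \<bar>(u (p + \<xi>) + u (p - \<xi>)) - (u (p + \<xi>') + u (p - \<xi>'))\<bar> \<le> K * d powr \<sigma> * r"
  using assms unfolding even_part_bound_def by blast

text \<open>The choice \<xi>' = 0 and r = d makes the factor d cancel and leaves a bound on second
  differences with no loss.\<close>

lemma even_part_boundD0:
  assumes "even_part_bound K \<sigma> u" "0 < d" "norm v \<le> d"
  shows "\<bar>u (p + v) + u (p - v) - 2 * u p\<bar> \<le> K * d powr \<sigma>"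
proof -
  have "d * \<bar>(u (p + v) + u (p - v)) - (u (p + 0) + u (p - 0))\<bar> \<le> K * d powr \<sigma> * d"
    using assms by (intro even_part_boundD) auto
  then show ?thesis using \<open>0 < d\<close> by simp
qed

text \<open>Two Hoelder differences, each at most \<open>M * d powr \<sigma>\<close>, give the
  factor 2; replacing d by r on one side passes to the weaker form shared with smoother
  functions.\<close>

lemma even_part_bound_holder:
  fixes u :: "'a::real_normed_vector \<Rightarrow> real"
  assumes M: "\<And>x y. \<bar>u x - u y\<bar> \<le> M * dist x y powr \<sigma>" and "0 \<le> \<sigma>" "0 \<le> M"
  shows "even_part_bound (2 * M) \<sigma> u"
  unfolding even_part_bound_def
proof (intro allI impI)
  fix p \<xi> \<xi>' :: 'a and d r :: real
  assume d: "0 < d" "d \<le> r" "norm \<xi> \<le> r" "norm \<xi>' \<le> r" "norm (\<xi> - \<xi>') \<le> d"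
  have *: "M * norm (\<xi> - \<xi>') powr \<sigma> \<le> M * d powr \<sigma>"
    using d assms by (intro mult_left_mono powr_mono2) auto
  have "\<bar>u (p + \<xi>) - u (p + \<xi>')\<bar> \<le> M * d powr \<sigma>" "\<bar>u (p - \<xi>) - u (p - \<xi>')\<bar> \<le> M * d powr \<sigma>"
    using M[of "p + \<xi>" "p + \<xi>'"] M[of "p - \<xi>" "p - \<xi>'"] * by (auto simp: dist_norm norm_minus_commute)
  then have "\<bar>(u (p + \<xi>) + u (p - \<xi>)) - (u (p + \<xi>') + u (p - \<xi>'))\<bar> \<le> 2 * M * d powr \<sigma>"
    by linarith
  then have "d * \<bar>(u (p + \<xi>) + u (p - \<xi>)) - (u (p + \<xi>') + u (p - \<xi>'))\<bar> \<le> r * (2 * M * d powr \<sigma>)"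
    using d by (intro mult_mono) auto
  then show "d * \<bar>(u (p + \<xi>) + u (p - \<xi>)) - (u (p + \<xi>') + u (p - \<xi>'))\<bar> \<le> 2 * M * d powr \<sigma> * r"
    by (simp add: mult_ac)
qed

text \<open>Along the segment the derivative of the even part is a difference of \<open>D\<close> at
  two points 2 (\<zeta> + t e) apart. Evenness thus turns Hoelder continuity of the derivative into
  smallness of order r^s, beyond the plain mean value estimate.\<close>

lemma even_part_direction_bound:
  fixes u :: "'a::real_normed_vector \<Rightarrow> real"
  assumes D: "\<And>x. ((\<lambda>t. u (x + t *\<^sub>R e)) has_real_derivative D x) (at 0)"
    and M: "\<And>x y. \<bar>D x - D y\<bar> \<le> M * dist x y powr s" and s: "0 \<le> s" and M0: "0 \<le> M"
    and r: "\<And>t. \<bar>t\<bar> \<le> \<bar>\<tau>\<bar> \<Longrightarrow> norm (\<zeta> + t *\<^sub>R e) \<le> r"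
  shows "\<bar>(u (p + (\<zeta> + \<tau> *\<^sub>R e)) + u (p - (\<zeta> + \<tau> *\<^sub>R e))) - (u (p + \<zeta>) + u (p - \<zeta>))\<bar> \<le> M * (2 * r) powr s * \<bar>\<tau>\<bar>"
proof -
  \<comment> \<open>The hypothesis differentiates only at parameter 0, but for every base point;
    moving the base point along \<open>e\<close> gives the derivative at every t.\<close>
  have D': "((\<lambda>t. u (x + t *\<^sub>R e)) has_real_derivative D (x + t *\<^sub>R e)) (at t)" for x t
  proof -
    have "((\<lambda>s. u ((x + t *\<^sub>R e) + s *\<^sub>R e)) has_real_derivative D (x + t *\<^sub>R e)) (at (t + - t))"
      using D[of "x + t *\<^sub>R e"] by simp
    then have "((\<lambda>s. u ((x + t *\<^sub>R e) + (s + - t) *\<^sub>R e)) has_real_derivative D (x + t *\<^sub>R e)) (at t)"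
      by (simp only: DERIV_shift)
    then show ?thesis by (simp add: algebra_simps)
  qed
  have D'': "((\<lambda>t. u (x - t *\<^sub>R e)) has_real_derivative - D (x - t *\<^sub>R e)) (at t)" for x t
    using DERIV_mirror[of "\<lambda>t. u (x + t *\<^sub>R e)" "D (x - t *\<^sub>R e)" t] D'[of x "-t"] by simp
  let ?F = "\<lambda>t. u (p + (\<zeta> + t *\<^sub>R e)) + u (p - (\<zeta> + t *\<^sub>R e))"
  have "norm (?F \<tau> - ?F 0) \<le> M * (2 * r) powr s * norm (\<tau> - 0)"
  proof (rule field_differentiable_bound[where S="closed_segment 0 \<tau>"
      and f'="\<lambda>t. D (p + \<zeta> + t *\<^sub>R e) + - D (p - \<zeta> - t *\<^sub>R e)"])
    fix t assume "t \<in> closed_segment 0 \<tau>"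
    then have t: "\<bar>t\<bar> \<le> \<bar>\<tau>\<bar>" by (auto simp: closed_segment_eq_real_ivl split: if_splits)
    show "(?F has_field_derivative D (p + \<zeta> + t *\<^sub>R e) + - D (p - \<zeta> - t *\<^sub>R e)) (at t within closed_segment 0 \<tau>)"
      using DERIV_add[OF D'[of "p + \<zeta>" t] D''[of "p - \<zeta>" t]]
      by (auto simp: algebra_simps intro: has_field_derivative_at_within)
    have "dist (p + \<zeta> + t *\<^sub>R e) (p - \<zeta> - t *\<^sub>R e) = norm ((\<zeta> + t *\<^sub>R e) + (\<zeta> + t *\<^sub>R e))"
      unfolding dist_norm by (rule arg_cong[where f=norm]) (simp add: algebra_simps)
    also have "\<dots> \<le> 2 * r" using r[OF t] norm_triangle_ineq[of "\<zeta> + t *\<^sub>R e" "\<zeta> + t *\<^sub>R e"] by linarith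
    finally have "M * dist (p + \<zeta> + t *\<^sub>R e) (p - \<zeta> - t *\<^sub>R e) powr s \<le> M * (2 * r) powr s"
      using s M0 by (intro mult_left_mono powr_mono2) auto
    then show "norm (D (p + \<zeta> + t *\<^sub>R e) + - D (p - \<zeta> - t *\<^sub>R e)) \<le> M * (2 * r) powr s"
      using M[of "p + \<zeta> + t *\<^sub>R e" "p - \<zeta> - t *\<^sub>R e"] by simp
  qed auto
  then show ?thesis by simp
qed

lemma holder_space_even_part_bound_0:
  assumes "u \<in> holder_space 0 s" "0 \<le> s"
  shows "\<exists>K\<ge>0. even_part_bound K s u"
proof -
  from assms obtain M where M: "\<And>x y. \<bar>u x - u y\<bar> \<le> M * dist x y powr s"
    unfolding holder_space_def by fastforce
  have "\<bar>u x - u y\<bar> \<le> \<bar>M\<bar> * dist x y powr s" for x y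
    using M[of x y] by (rule order_trans) (auto intro: mult_right_mono)
  then have "even_part_bound (2 * \<bar>M\<bar>) s u" using assms by (intro even_part_bound_holder) auto
  then show ?thesis by (intro exI[of _ "2 * \<bar>M\<bar>"]) auto
qed

text \<open>\<open>holder_space\<close> provides derivatives along the axes only, so \<xi>' is
  joined to \<xi> by two axis-parallel legs through \<xi> - (0, snd \<tau>), each treated by
  \<open>even_part_direction_bound\<close>.\<close>

lemma holder_space_even_part_bound_1:
  assumes u: "u \<in> holder_space 1 s" and s: "0 \<le> s" "s \<le> 1"
  shows "\<exists>K\<ge>0. even_part_bound K (1 + s) u"
proof -
  have D: "((\<lambda>t. u (x + t *\<^sub>R e)) has_real_derivative dir_deriv u e x) (at 0)" if "e \<in> Basis" for e x
  proof -
    have "(\<lambda>t. iter_pd [] u (x + t *\<^sub>R e)) differentiable (at 0)"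
      using u that unfolding holder_space_def mem_Collect_eq
      by (elim conjE allE[of _ "[]::(real \<times> real) list"]) (cases x, simp)
    then show ?thesis
      by (simp add: dir_deriv_def DERIV_deriv_iff_real_differentiable)
  qed
  have "\<exists>M. \<forall>x y. \<bar>dir_deriv u e x - dir_deriv u e y\<bar> \<le> M * dist x y powr s" if "e \<in> Basis" for e
  proof -
    have "set [e] \<subseteq> Basis \<and> length [e] = 1" using that by simp
    then have "\<exists>M. \<forall>x y. \<bar>iter_pd [e] u x - iter_pd [e] u y\<bar> \<le> M * dist x y powr s"
      using u unfolding holder_space_def by blast
    then show ?thesis by simp
  qed
  then obtain M' where M': "\<And>e x y. e \<in> Basis \<Longrightarrow> \<bar>dir_deriv u e x - dir_deriv u e y\<bar> \<le> M' e * dist x y powr s"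
    by metis
  define M where "M = \<bar>M' (1, 0)\<bar> + \<bar>M' (0, 1)\<bar>"
  have M0: "0 \<le> M" by (simp add: M_def)
  have basis: "(1, 0) \<in> (Basis :: (real \<times> real) set)" "(0, 1) \<in> (Basis :: (real \<times> real) set)"
    by (auto simp: Basis_prod_def)
  have M: "\<bar>dir_deriv u e x - dir_deriv u e y\<bar> \<le> M * dist x y powr s" if "e = (1, 0) \<or> e = (0, 1)" for e x y
  proof -
    have "\<bar>dir_deriv u e x - dir_deriv u e y\<bar> \<le> M' e * dist x y powr s" using that basis M' by blast
    also have "\<dots> \<le> M * dist x y powr s" using that by (intro mult_right_mono) (auto simp: M_def)
    finally show ?thesis .
  qed
  have "even_part_bound (12 * M) (1 + s) u"
    unfolding even_part_bound_def
  proof (intro allI impI)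
    fix p \<xi> \<xi>' :: "real \<times> real" and d r :: real
    assume d: "0 < d" "d \<le> r" "norm \<xi> \<le> r" "norm \<xi>' \<le> r" "norm (\<xi> - \<xi>') \<le> d"
    define \<tau> where "\<tau> = \<xi> - \<xi>'"
    let ?W = "\<lambda>\<zeta>. u (p + \<zeta>) + u (p - \<zeta>)"
    have \<tau>: "\<bar>fst \<tau>\<bar> \<le> d" "\<bar>snd \<tau>\<bar> \<le> d"
      using norm_fst_le[of "fst \<tau>" "snd \<tau>"] norm_snd_le[of "snd \<tau>" "fst \<tau>"] d(5)[folded \<tau>_def] by simp_all
    have split1: "\<xi> = (\<xi> - (0, snd \<tau>)) + snd \<tau> *\<^sub>R (0, 1)" by (cases \<xi>) (simp add: \<tau>_def)
    have split2: "\<xi> - (0, snd \<tau>) = \<xi>' + fst \<tau> *\<^sub>R (1, 0)" by (cases \<xi>; cases \<xi>') (simp add: \<tau>_def)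
    \<comment> \<open>The intermediate point has norm at most r + d, the parameter adds at most d,
      and d \<le> r.\<close>
    have n1: "norm ((\<xi> - (0, snd \<tau>)) + t *\<^sub>R (0, 1)) \<le> 3 * r" if "\<bar>t\<bar> \<le> \<bar>snd \<tau>\<bar>" for t
      using that \<tau> d norm_triangle_ineq4[of \<xi> "(0, snd \<tau>)"]
        norm_triangle_ineq[of "\<xi> - (0, snd \<tau>)" "t *\<^sub>R (0, 1)"] by (simp add: norm_Pair)
    have n2: "norm (\<xi>' + t *\<^sub>R (1, 0)) \<le> 3 * r" if "\<bar>t\<bar> \<le> \<bar>fst \<tau>\<bar>" for t
      using that \<tau> d norm_triangle_ineq[of \<xi>' "t *\<^sub>R (1, 0)"] by (simp add: norm_Pair)
    have "\<bar>?W ((\<xi> - (0, snd \<tau>)) + snd \<tau> *\<^sub>R (0, 1)) - ?W (\<xi> - (0, snd \<tau>))\<bar> \<le> M * (2 * (3 * r)) powr s * \<bar>snd \<tau>\<bar>"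
      by (rule even_part_direction_bound[OF D[OF basis(2)] M[OF disjI2[OF refl]] s(1) M0 n1])
    then have W1: "\<bar>?W \<xi> - ?W (\<xi> - (0, snd \<tau>))\<bar> \<le> M * (6 * r) powr s * \<bar>snd \<tau>\<bar>"
      unfolding split1[symmetric] by simp
    have "\<bar>?W (\<xi>' + fst \<tau> *\<^sub>R (1, 0)) - ?W \<xi>'\<bar> \<le> M * (2 * (3 * r)) powr s * \<bar>fst \<tau>\<bar>"
      by (rule even_part_direction_bound[OF D[OF basis(1)] M[OF disjI1[OF refl]] s(1) M0 n2])
    then have W2: "\<bar>?W (\<xi> - (0, snd \<tau>)) - ?W \<xi>'\<bar> \<le> M * (6 * r) powr s * \<bar>fst \<tau>\<bar>"
      unfolding split2[symmetric] by simp
    define Q where "Q = M * (6 * r) powr s"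
    have Q0: "0 \<le> Q" using M0 by (simp add: Q_def)
    have "\<bar>?W \<xi> - ?W \<xi>'\<bar> \<le> Q * \<bar>snd \<tau>\<bar> + Q * \<bar>fst \<tau>\<bar>"
      using W1 W2 unfolding Q_def by linarith
    also have "\<dots> \<le> Q * d + Q * d"
      using \<tau> Q0 by (intro add_mono mult_left_mono) auto
    finally have "d * \<bar>?W \<xi> - ?W \<xi>'\<bar> \<le> d * (Q * d + Q * d)"
      using d by (intro mult_left_mono) auto
    also have "\<dots> = 2 * M * (6 powr s * r powr s) * d * d"
      using d by (simp add: Q_def powr_mult)
    also have "\<dots> \<le> 2 * M * (6 * r powr s) * d * d"
      using d M0 s powr_mono[of s 1 6] by (intro mult_right_mono mult_left_mono) auto
    also have "\<dots> = 12 * M * d * (r powr s * d)" by simp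
    \<comment> \<open>Here s \<le> 1 enters: d \<le> r implies r^s d \<le> d^s r. The 12 collects
      two legs and the bound 6 for \<open>6 powr s\<close>.\<close>
    also have "\<dots> \<le> 12 * M * d * (d powr s * r)"
    proof -
      have "d powr (1 - s) \<le> r powr (1 - s)" using d s by (intro powr_mono2) auto
      then have "(r powr s * d powr s) * d powr (1 - s) \<le> (r powr s * d powr s) * r powr (1 - s)"
        by (intro mult_left_mono) auto
      moreover have "d powr s * d powr (1 - s) = d" "r powr s * r powr (1 - s) = r"
        using d by (simp_all flip: powr_add)
      ultimately have "r powr s * d \<le> d powr s * r" by (metis mult.assoc mult.commute)
      then show ?thesis using M0 d by (intro mult_left_mono) auto
    qed
    also have "\<dots> = 12 * M * d powr (1 + s) * r" using d by (simp add: powr_add)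
    finally show "d * \<bar>?W \<xi> - ?W \<xi>'\<bar> \<le> 12 * M * d powr (1 + s) * r" .
  qed
  then show ?thesis using M0 by (intro exI[of _ "12 * M"]) auto
qed

subsection \<open>Integration over the quadrant\<close>

abbreviation quadrant :: "(real \<times> real) set" where
  "quadrant \<equiv> {\<xi>. 0 \<le> fst \<xi> \<and> 0 \<le> snd \<xi>}"

lemma quadrant_sets[measurable, simp]: "quadrant \<in> sets borel"
proof -
  have "{\<xi> \<in> space borel. 0 \<le> fst \<xi> \<and> 0 \<le> snd \<xi>} \<in> sets (borel :: (real \<times> real) measure)"
    unfolding borel_prod[symmetric] by measurable
  then show ?thesis by simp
qed

text \<open>The reflected quadrants overlap on the axes, and the one-dimensional factors used for
  domination are 0 there since \<open>0 powr a = 0\<close>. Folding and tensor bounds therefore hold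
  only off this null set.\<close>

lemma AE_lborel_off_axes: "AE \<xi> in (lborel :: (real \<times> real) measure). fst \<xi> \<noteq> 0 \<and> snd \<xi> \<noteq> 0"
proof -
  have b: "(1, 0) \<in> (Basis :: (real \<times> real) set)" "(0, 1) \<in> (Basis :: (real \<times> real) set)"
    by (auto simp: Basis_prod_def)
  show ?thesis
    using AE_lborel_inner_neq[OF b(1), of 0] AE_lborel_inner_neq[OF b(2), of 0]
    by eventually_elim (auto simp: inner_prod_def)
qed

lemma nn_integral_lborel_tensor:
  fixes f :: "real \<Rightarrow> real"
  assumes [measurable]: "f \<in> borel_measurable borel" and "\<And>x. 0 \<le> f x"
  shows "(\<integral>\<^sup>+\<xi>. ennreal (f (fst \<xi>) * f (snd \<xi>)) \<partial>lborel) = (\<integral>\<^sup>+x. f x \<partial>lborel) * (\<integral>\<^sup>+x. f x \<partial>lborel)"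
proof -
  have "(\<integral>\<^sup>+\<xi>. ennreal (f (fst \<xi>) * f (snd \<xi>)) \<partial>lborel)
      = (\<integral>\<^sup>+\<xi>. ennreal (f (fst \<xi>) * f (snd \<xi>)) \<partial>(lborel \<Otimes>\<^sub>M lborel))"
    by (simp add: lborel_prod)
  also have "\<dots> = (\<integral>\<^sup>+x. \<integral>\<^sup>+y. ennreal (f x) * ennreal (f y) \<partial>lborel \<partial>lborel)"
    using assms by (subst lborel.nn_integral_fst[symmetric]) (auto simp: ennreal_mult)
  also have "\<dots> = (\<integral>\<^sup>+x. f x \<partial>lborel) * (\<integral>\<^sup>+x. f x \<partial>lborel)"
    by (simp add: nn_integral_cmult nn_integral_multc)
  finally show ?thesis .
qed

text \<open>Each coordinate is at most the norm and the exponent is nonpositive, so half of the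
  power can be charged to each coordinate. The square of the integral of t^(p/2-1) over [0, h],
  which is (2/p) h^(p/2), replaces polar coordinates.\<close>

lemma integral_norm_powr_cell00:
  assumes p: "0 < p" "p \<le> 2" and h: "0 \<le> h"
  shows "set_integrable lborel (cell h 0 0) (\<lambda>\<xi>. norm \<xi> powr (p - 2))"
    and "integral (cell h 0 0) (\<lambda>\<xi>. norm \<xi> powr (p - 2)) \<le> (2 / p)\<^sup>2 * h powr p"
proof -
  define f where "f = (\<lambda>t::real. indicator {0..h} t * t powr (p/2 - 1))"
  have [measurable]: "f \<in> borel_measurable borel" unfolding f_def by measurable
  have f0: "0 \<le> f t" for t by (simp add: f_def)
  have "(\<integral>\<^sup>+t. f t \<partial>lborel) = ennreal (h powr (p/2 - 1 + 1) / (p/2 - 1 + 1))"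
    unfolding f_def using p h
    by (intro nn_integral_has_integral_lebesgue has_integral_powr_from_0) auto
  then have fi: "(\<integral>\<^sup>+t. f t \<partial>lborel) = ennreal (h powr (p/2) * (2/p))" by simp
  let ?F = "\<lambda>\<xi>::real\<times>real. indicator (cell h 0 0) \<xi> * norm \<xi> powr (p - 2)"
  have "(\<integral>\<^sup>+\<xi>. ennreal (?F \<xi>) \<partial>lborel) \<le> (\<integral>\<^sup>+\<xi>. ennreal (f (fst \<xi>) * f (snd \<xi>)) \<partial>lborel)"
  proof (rule nn_integral_mono_AE)
    show "AE \<xi> in lborel. ennreal (?F \<xi>) \<le> ennreal (f (fst \<xi>) * f (snd \<xi>))"
      using AE_lborel_off_axes
    proof eventually_elim
      fix \<xi> :: "real \<times> real" assume ne: "fst \<xi> \<noteq> 0 \<and> snd \<xi> \<noteq> 0"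
      show "ennreal (?F \<xi>) \<le> ennreal (f (fst \<xi>) * f (snd \<xi>))"
      proof (cases "\<xi> \<in> cell h 0 0")
        case True
        then have c: "0 < fst \<xi>" "fst \<xi> \<le> h" "0 < snd \<xi>" "snd \<xi> \<le> h"
          using ne by (cases \<xi>; auto simp: cell_def cbox_Pair_eq)+
        have n: "fst \<xi> \<le> norm \<xi>" "snd \<xi> \<le> norm \<xi>"
          using norm_fst_le[of "fst \<xi>" "snd \<xi>"] norm_snd_le[of "snd \<xi>" "fst \<xi>"] c by simp_all
        have "norm \<xi> powr (p - 2) = norm \<xi> powr (p/2 - 1) * norm \<xi> powr (p/2 - 1)"
          by (simp flip: powr_add)
        also have "\<dots> \<le> fst \<xi> powr (p/2 - 1) * snd \<xi> powr (p/2 - 1)"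
          using n c p by (intro mult_mono powr_mono2') auto
        finally show ?thesis using True c by (intro ennreal_leI) (simp add: f_def)
      qed (simp add: f0)
    qed
  qed
  also have "\<dots> = ennreal (h powr (p/2) * (2/p)) * ennreal (h powr (p/2) * (2/p))"
    using f0 by (subst nn_integral_lborel_tensor) (auto simp: fi)
  also have "\<dots> = ennreal ((2 / p)\<^sup>2 * h powr p)"
    using p by (simp add: power2_eq_square field_simps flip: powr_add ennreal_mult)
  finally have le: "(\<integral>\<^sup>+\<xi>. ennreal (?F \<xi>) \<partial>lborel) \<le> ennreal ((2 / p)\<^sup>2 * h powr p)" .
  have m: "?F \<in> borel_measurable lborel"
    unfolding cell_def by measurable
  have int: "integrable lborel ?F"
    using m le by (intro integrableI_nonneg) (auto simp: top_unique less_top[symmetric])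
  then show s: "set_integrable lborel (cell h 0 0) (\<lambda>\<xi>. norm \<xi> powr (p - 2))"
    by (simp add: set_integrable_def)
  have "integral (cell h 0 0) (\<lambda>\<xi>. norm \<xi> powr (p - 2)) = integral\<^sup>L lborel ?F"
    using set_borel_integral_eq_integral(2)[OF s] by (simp add: set_lebesgue_integral_def)
  also have "\<dots> \<le> (2 / p)\<^sup>2 * h powr p"
  proof -
    have "ennreal (integral\<^sup>L lborel ?F) \<le> ennreal ((2 / p)\<^sup>2 * h powr p)"
      using le by (subst nn_integral_eq_integral[symmetric]) (auto simp: int)
    then show ?thesis by (subst (asm) ennreal_le_iff) auto
  qed
  finally show "integral (cell h 0 0) (\<lambda>\<xi>. norm \<xi> powr (p - 2)) \<le> (2 / p)\<^sup>2 * h powr p" .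
qed

text \<open>The radial majorant is a square of a decreasing function, so it is dominated by a tensor product.\<close>

lemma integrable_radial_majorant:
  assumes e: "0 < e" "e \<le> 2" and \<alpha>: "0 < \<alpha>"
  shows "integrable lborel (\<lambda>\<xi>. indicator quadrant \<xi> * min (norm \<xi> powr (e - 2)) (norm \<xi> powr (-(2 + \<alpha>))))"
proof -
  define \<phi> where "\<phi> = (\<lambda>t::real. indicator {0..} t * min (t powr (e/2 - 1)) (t powr (-1 - \<alpha>/2)))"
  have [measurable]: "\<phi> \<in> borel_measurable borel" unfolding \<phi>_def by measurable
  have \<phi>0: "0 \<le> \<phi> t" for t by (simp add: \<phi>_def)
  have "(\<integral>\<^sup>+t. \<phi> t \<partial>lborel) \<le>
      (\<integral>\<^sup>+t. ennreal (indicator {0..1} t * t powr (e/2 - 1)) + ennreal (indicator {1..} t * t powr (-1 - \<alpha>/2)) \<partial>lborel)"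
    by (intro nn_integral_mono) (auto simp: \<phi>_def indicator_def simp flip: ennreal_plus intro!: ennreal_leI)
  also have "\<dots> = (\<integral>\<^sup>+t. ennreal (indicator {0..1} t * t powr (e/2 - 1)) \<partial>lborel)
      + (\<integral>\<^sup>+t. ennreal (indicator {1..} t * t powr (-1 - \<alpha>/2)) \<partial>lborel)"
    by (intro nn_integral_add) auto
  also have "(\<integral>\<^sup>+t. ennreal (indicator {0..1} t * t powr (e/2 - 1)) \<partial>lborel) = ennreal (1 powr (e/2 - 1 + 1) / (e/2 - 1 + 1))"
    using e by (intro nn_integral_has_integral_lebesgue has_integral_powr_from_0) auto
  also have "(\<integral>\<^sup>+t. ennreal (indicator {1..} t * t powr (-1 - \<alpha>/2)) \<partial>lborel) = ennreal (- (1 powr (-1 - \<alpha>/2 + 1)) / (-1 - \<alpha>/2 + 1))"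
    using \<alpha> by (intro nn_integral_has_integral_lebesgue has_integral_powr_to_inf) auto
  finally have fin: "(\<integral>\<^sup>+t. \<phi> t \<partial>lborel) < \<infinity>"
    by (rule le_less_trans) (simp add: ennreal_add_eq_top less_top)
  let ?F = "\<lambda>\<xi>::real\<times>real. indicator quadrant \<xi> * min (norm \<xi> powr (e - 2)) (norm \<xi> powr (-(2 + \<alpha>)))"
  have "(\<integral>\<^sup>+\<xi>. ennreal (?F \<xi>) \<partial>lborel) \<le> (\<integral>\<^sup>+\<xi>. ennreal (\<phi> (fst \<xi>) * \<phi> (snd \<xi>)) \<partial>lborel)"
  proof (rule nn_integral_mono_AE)
    show "AE \<xi> in lborel. ennreal (?F \<xi>) \<le> ennreal (\<phi> (fst \<xi>) * \<phi> (snd \<xi>))"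
      using AE_lborel_off_axes
    proof eventually_elim
      fix \<xi> :: "real \<times> real" assume ne: "fst \<xi> \<noteq> 0 \<and> snd \<xi> \<noteq> 0"
      show "ennreal (?F \<xi>) \<le> ennreal (\<phi> (fst \<xi>) * \<phi> (snd \<xi>))"
      proof (cases "\<xi> \<in> quadrant")
        case True
        then have c: "0 < fst \<xi>" "0 < snd \<xi>" using ne by auto
        have n: "fst \<xi> \<le> norm \<xi>" "snd \<xi> \<le> norm \<xi>"
          using norm_fst_le[of "fst \<xi>" "snd \<xi>"] norm_snd_le[of "snd \<xi>" "fst \<xi>"] c by simp_all
        have mono: "min (norm \<xi> powr (e/2 - 1)) (norm \<xi> powr (-1 - \<alpha>/2)) \<le> \<phi> t" if "0 < t" "t \<le> norm \<xi>" for t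
        proof -
          have "\<phi> t = min (t powr (e/2 - 1)) (t powr (-1 - \<alpha>/2))" using that by (simp add: \<phi>_def)
          moreover have "norm \<xi> powr (e/2 - 1) \<le> t powr (e/2 - 1)" "norm \<xi> powr (-1 - \<alpha>/2) \<le> t powr (-1 - \<alpha>/2)"
            using that e \<alpha> by (auto intro!: powr_mono2')
          ultimately show ?thesis by (metis min.mono)
        qed
        have "min (norm \<xi> powr (e - 2)) (norm \<xi> powr (-(2 + \<alpha>)))
            \<le> min (norm \<xi> powr (e/2 - 1)) (norm \<xi> powr (-1 - \<alpha>/2)) * min (norm \<xi> powr (e/2 - 1)) (norm \<xi> powr (-1 - \<alpha>/2))"
        proof -
          have "norm \<xi> powr (e - 2) = norm \<xi> powr (e/2 - 1) * norm \<xi> powr (e/2 - 1)"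
            "norm \<xi> powr (-(2 + \<alpha>)) = norm \<xi> powr (-1 - \<alpha>/2) * norm \<xi> powr (-1 - \<alpha>/2)"
            by (simp_all flip: powr_add)
          then show ?thesis by (auto simp: min_def)
        qed
        also have "\<dots> \<le> \<phi> (fst \<xi>) * \<phi> (snd \<xi>)"
          using n c \<phi>0 by (intro mult_mono mono) auto
        finally show ?thesis using True by (intro ennreal_leI) simp
      qed (simp add: \<phi>0)
    qed
  qed
  also have "\<dots> < \<infinity>"
    using fin \<phi>0 by (subst nn_integral_lborel_tensor) (auto simp: ennreal_mult_less_top)
  finally have le: "(\<integral>\<^sup>+\<xi>. ennreal (?F \<xi>) \<partial>lborel) < \<infinity>" .
  have "?F \<in> borel_measurable lborel" by measurable
  then show ?thesis
    using le by (intro integrableI_nonneg) auto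
qed

section \<open>Reflections in the axes and folding\<close>

lemma lborel_distr_reflect:
  assumes "\<bar>a\<bar> = 1" "\<bar>b\<bar> = 1"
  shows "distr lborel borel (\<lambda>\<xi>::real\<times>real. (a * fst \<xi>, b * snd \<xi>)) = lborel"
proof -
  let ?c = "\<lambda>j::real\<times>real. if j = (1, 0) then a else b"
  have B: "(Basis :: (real \<times> real) set) = {(1, 0), (0, 1)}"
    by (auto simp: Basis_prod_def)
  have "lborel = density (distr lborel borel (\<lambda>x::real\<times>real. 0 + (\<Sum>j\<in>Basis. (?c j * (x \<bullet> j)) *\<^sub>R j))) (\<lambda>_. (\<Prod>j\<in>Basis. \<bar>?c j\<bar>))"
    using assms by (intro lborel_affine_euclidean) auto
  also have "(\<lambda>x::real\<times>real. 0 + (\<Sum>j\<in>Basis. (?c j * (x \<bullet> j)) *\<^sub>R j)) = (\<lambda>\<xi>. (a * fst \<xi>, b * snd \<xi>))"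
    by (auto simp: B inner_prod_def)
  also have "(\<lambda>_. ennreal (\<Prod>j\<in>Basis. \<bar>?c j\<bar>)) = (\<lambda>_::real\<times>real. 1)"
    using assms by (auto simp: B)
  finally show ?thesis by (simp add: density_1)
qed

lemma measurable_reflect: "(\<lambda>\<xi>::real\<times>real. (a * fst \<xi>, b * snd \<xi>)) \<in> borel \<rightarrow>\<^sub>M borel"
  by (intro borel_measurable_continuous_onI continuous_intros)

lemma integral_fold_quadrant:
  fixes F :: "real \<times> real \<Rightarrow> real"
  assumes F[measurable]: "F \<in> borel_measurable borel"
    and int: "\<And>m n. integrable lborel (\<lambda>\<xi>. indicator quadrant \<xi> * F ((-1) ^ m * fst \<xi>, (-1) ^ n * snd \<xi>))"
  shows "integral\<^sup>L lborel F = (LINT \<xi>|lborel. indicator quadrant \<xi> *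
            (\<Sum>m\<in>{0::nat,1}. \<Sum>n\<in>{0::nat,1}. F ((-1) ^ m * fst \<xi>, (-1) ^ n * snd \<xi>)))"
    and "integrable lborel F"
proof -
  define r where "r = (\<lambda>m n (\<xi>::real\<times>real). ((-1) ^ m * fst \<xi>, (-1) ^ n * snd \<xi>) :: real\<times>real)" for m n :: nat
  have r_meas[measurable]: "r m n \<in> borel \<rightarrow>\<^sub>M borel" for m n
    unfolding r_def by (rule measurable_reflect)
  have d: "distr lborel borel (r m n) = lborel" for m n
    unfolding r_def by (rule lborel_distr_reflect) (auto simp: power_abs)
  have rr: "r m n (r m n \<xi>) = \<xi>" for m n \<xi>
    by (simp add: r_def mult.assoc[symmetric] power_mult_distrib[symmetric])
  define G where "G = (\<lambda>m n \<xi>. indicator quadrant \<xi> * F (r m n \<xi>))"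
  have G[measurable]: "G m n \<in> borel_measurable borel" for m n unfolding G_def by measurable
  have hb: "has_bochner_integral lborel (\<lambda>\<xi>. G m n (r m n \<xi>)) (integral\<^sup>L lborel (G m n))" for m n
  proof -
    have "integrable (distr lborel borel (r m n)) (G m n)"
      unfolding d using int by (simp add: G_def r_def)
    then have "integrable lborel (\<lambda>\<xi>. G m n (r m n \<xi>))"
      by (subst (asm) integrable_distr_eq) auto
    moreover have "integral\<^sup>L (distr lborel borel (r m n)) (G m n) = integral\<^sup>L lborel (\<lambda>\<xi>. G m n (r m n \<xi>))"
      by (rule integral_distr) auto
    ultimately show ?thesis unfolding d by (simp add: has_bochner_integral_iff)
  qed
  let ?S = "{0::nat,1}"
  have hbs: "has_bochner_integral lborel (\<lambda>\<xi>. \<Sum>m\<in>?S. \<Sum>n\<in>?S. G m n (r m n \<xi>)) (\<Sum>m\<in>?S. \<Sum>n\<in>?S. integral\<^sup>L lborel (G m n))"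
    by (intro has_bochner_integral_sum hb)
  have ae: "AE \<xi> in lborel. (\<Sum>m\<in>?S. \<Sum>n\<in>?S. G m n (r m n \<xi>)) = F \<xi>"
    using AE_lborel_off_axes
  proof eventually_elim
    fix \<xi> :: "real \<times> real" assume ne: "fst \<xi> \<noteq> 0 \<and> snd \<xi> \<noteq> 0"
    have sum4: "(\<Sum>m\<in>?S. \<Sum>n\<in>?S. f m n) = f 0 0 + f 0 1 + f 1 0 + f 1 1" for f :: "nat \<Rightarrow> nat \<Rightarrow> real"
      by simp
    show "(\<Sum>m\<in>?S. \<Sum>n\<in>?S. G m n (r m n \<xi>)) = F \<xi>"
      unfolding sum4 G_def rr using ne
      by (cases "0 < fst \<xi>"; cases "0 < snd \<xi>") (simp_all add: r_def)
  qed
  have hF: "has_bochner_integral lborel F (\<Sum>m\<in>?S. \<Sum>n\<in>?S. integral\<^sup>L lborel (G m n))"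
    using hbs by (subst (asm) has_bochner_integral_cong_AE[OF _ _ ae]) auto
  then show "integrable lborel F" by (simp add: has_bochner_integral_iff)
  have "integral\<^sup>L lborel F = (\<Sum>m\<in>?S. \<Sum>n\<in>?S. integral\<^sup>L lborel (G m n))"
    using hF by (simp add: has_bochner_integral_iff)
  also have "\<dots> = (LINT \<xi>|lborel. (\<Sum>m\<in>?S. \<Sum>n\<in>?S. G m n \<xi>))"
    using int by (intro has_bochner_integral_integral_eq[symmetric] has_bochner_integral_sum has_bochner_integral_integrable)
      (simp add: G_def r_def)
  finally show "integral\<^sup>L lborel F = (LINT \<xi>|lborel. indicator quadrant \<xi> *
            (\<Sum>m\<in>?S. \<Sum>n\<in>?S. F ((-1) ^ m * fst \<xi>, (-1) ^ n * snd \<xi>)))"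
    unfolding G_def r_def sum_distrib_left .
qed

subsection \<open>The fractional Laplacian as an integral of second differences\<close>

text \<open>This is the numerator of \<open>psi\<close>, free of \<gamma>; the singular integral and
  all splittings share it.\<close>

definition quad_diff :: "(real \<times> real \<Rightarrow> real) \<Rightarrow> real \<times> real \<Rightarrow> real \<times> real \<Rightarrow> real" where
  "quad_diff u x \<xi> = (\<Sum>m\<in>{0::nat,1}. \<Sum>n\<in>{0::nat,1}.
     u (fst x + (-1) ^ m * fst \<xi>, snd x + (-1) ^ n * snd \<xi>)) - 4 * u x"

lemma psi_eq_quad_diff: "psi \<gamma> u x \<xi> = norm \<xi> powr (-\<gamma>) * quad_diff u x \<xi>"
  by (simp add: psi_def quad_diff_def)

lemma continuous_quad_diff:
  assumes "continuous_on UNIV u"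
  shows "continuous_on UNIV (quad_diff u x)"
  unfolding quad_diff_def
  by (intro continuous_intros continuous_on_compose2[OF assms]) auto

context
  fixes \<alpha> \<epsilon> K B :: real and u :: "real \<times> real \<Rightarrow> real" and x :: "real \<times> real"
  assumes \<alpha>: "0 < \<alpha>" and \<epsilon>: "0 < \<epsilon>" "\<epsilon> \<le> 2"
    and cont: "continuous_on UNIV u" and B: "\<And>y. \<bar>u y\<bar> \<le> B"
    and K: "\<And>\<xi>. \<bar>quad_diff u x \<xi>\<bar> \<le> K * norm \<xi> powr (\<alpha> + \<epsilon>)"
begin

text \<open>The first power reflects the second-difference bound near the origin, the second the
  boundedness of \<open>u\<close> far away.\<close>

private definition "majorant \<xi> = indicator quadrant \<xi> * min (norm \<xi> powr (\<epsilon> - 2)) (norm \<xi> powr (-(2 + \<alpha>)))"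
  for \<xi> :: "real \<times> real"

private lemma u_measurable [measurable]: "u \<in> borel_measurable borel"
  by (rule borel_measurable_continuous_onI[OF cont])

private lemma quad_diff_measurable [measurable]: "quad_diff u x \<in> borel_measurable borel"
  by (rule borel_measurable_continuous_onI[OF continuous_quad_diff[OF cont]])

private lemma majorant_integrable: "integrable lborel majorant"
  unfolding majorant_def using integrable_radial_majorant[OF \<epsilon> \<alpha>] .

private lemma B0: "0 \<le> B"
  using B[of x] by simp

text \<open>The 8 counts the four shifted values and the four copies of \<open>u x\<close>. Adding
  both constants gives a single one valid for each branch of the minimum.\<close>

private lemma kernel_le_majorant:
  "indicator quadrant \<xi> * \<bar>quad_diff u x \<xi> * norm \<xi> powr (-(2 + \<alpha>))\<bar> \<le> (\<bar>K\<bar> + 8 * B) * majorant \<xi>"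
proof (cases "\<xi> \<in> quadrant")
  case True
  have "\<bar>quad_diff u x \<xi>\<bar> \<le> \<bar>K\<bar> * norm \<xi> powr (\<alpha> + \<epsilon>)"
    using K[of \<xi>] by (rule order_trans) (auto intro: mult_right_mono)
  also have "\<dots> \<le> (\<bar>K\<bar> + 8 * B) * norm \<xi> powr (\<alpha> + \<epsilon>)"
    using B0 by (intro mult_right_mono) auto
  finally have "\<bar>quad_diff u x \<xi> * norm \<xi> powr (-(2 + \<alpha>))\<bar> \<le> (\<bar>K\<bar> + 8 * B) * norm \<xi> powr (\<alpha> + \<epsilon>) * norm \<xi> powr (-(2 + \<alpha>))"
    unfolding abs_mult by (intro mult_mono) auto
  also have "\<dots> = (\<bar>K\<bar> + 8 * B) * norm \<xi> powr (\<epsilon> - 2)"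
    by (simp add: mult.assoc flip: powr_add)
  finally have 1: "\<bar>quad_diff u x \<xi> * norm \<xi> powr (-(2 + \<alpha>))\<bar> \<le> (\<bar>K\<bar> + 8 * B) * norm \<xi> powr (\<epsilon> - 2)" .
  have "\<bar>quad_diff u x \<xi>\<bar> \<le> \<bar>K\<bar> + 8 * B"
    using B[of "(fst x + fst \<xi>, snd x + snd \<xi>)"] B[of "(fst x + fst \<xi>, snd x - snd \<xi>)"]
      B[of "(fst x - fst \<xi>, snd x + snd \<xi>)"] B[of "(fst x - fst \<xi>, snd x - snd \<xi>)"] B[of x]
    by (simp add: quad_diff_def)
  then have 2: "\<bar>quad_diff u x \<xi> * norm \<xi> powr (-(2 + \<alpha>))\<bar> \<le> (\<bar>K\<bar> + 8 * B) * norm \<xi> powr (-(2 + \<alpha>))"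
    unfolding abs_mult by (intro mult_mono) auto
  show ?thesis using 1 2 True by (simp add: majorant_def min_def)
qed (simp add: majorant_def)

lemma quad_diff_kernel_integrable: "set_integrable lborel quadrant (\<lambda>\<xi>. quad_diff u x \<xi> * norm \<xi> powr (-(2 + \<alpha>)))"
  unfolding set_integrable_def
proof (rule Bochner_Integration.integrable_bound)
  show "integrable lborel (\<lambda>\<xi>. (\<bar>K\<bar> + 8 * B) * majorant \<xi>)" using majorant_integrable by simp
  show "AE \<xi> in lborel. norm (indicat_real quadrant \<xi> *\<^sub>R (quad_diff u x \<xi> * norm \<xi> powr (-(2 + \<alpha>))))
      \<le> norm ((\<bar>K\<bar> + 8 * B) * majorant \<xi>)"
  proof (intro AE_I2)
    fix \<xi> :: "real \<times> real"
    have "norm (indicat_real quadrant \<xi> *\<^sub>R (quad_diff u x \<xi> * norm \<xi> powr (-(2 + \<alpha>))))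
        = indicator quadrant \<xi> * \<bar>quad_diff u x \<xi> * norm \<xi> powr (-(2 + \<alpha>))\<bar>"
      by (simp add: abs_mult)
    also have "\<dots> \<le> norm ((\<bar>K\<bar> + 8 * B) * majorant \<xi>)"
      unfolding real_norm_def by (rule order_trans[OF kernel_le_majorant abs_ge_self])
    finally show "norm (indicat_real quadrant \<xi> *\<^sub>R (quad_diff u x \<xi> * norm \<xi> powr (-(2 + \<alpha>))))
      \<le> norm ((\<bar>K\<bar> + 8 * B) * majorant \<xi>)" .
  qed
qed measurable

text \<open>With the singularity cut off, boundedness of \<open>u\<close> makes each reflected copy
  integrable by itself, so folding is allowed before any cancellation. The truncation is invariant
  under reflections, and the four copies add up to minus \<open>quad_diff\<close>.\<close>

private lemma truncated_integral:
  assumes \<delta>: "0 < \<delta>"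
  shows "integral {x'. \<delta> < dist x x'} (\<lambda>x'. (u x - u x') / dist x x' powr (2 + \<alpha>))
    = - (LINT \<xi>|lborel. indicator {\<xi>. \<delta> < norm \<xi>} \<xi> * (indicator quadrant \<xi> * (quad_diff u x \<xi> * norm \<xi> powr (-(2 + \<alpha>)))))"
proof -
  define F where "F = (\<lambda>\<xi>. indicator {\<xi>. \<delta> < norm \<xi>} \<xi> * ((u x - u (x + \<xi>)) * norm \<xi> powr (-(2 + \<alpha>))))"
  have F[measurable]: "F \<in> borel_measurable borel"
    unfolding F_def by measurable
  let ?r = "\<lambda>m n (\<xi>::real\<times>real). ((-1) ^ m * fst \<xi>, (-1) ^ n * snd \<xi>) :: real\<times>real"
  have nr: "norm (?r m n \<xi>) = norm \<xi>" for m n :: nat and \<xi>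
    by (cases \<xi>) (simp add: norm_Pair power_mult_distrib flip: power_mult)
  \<comment> \<open>On norms above \<delta> the factor \<delta>^(-(\<alpha>+\<epsilon>)) makes the
    decay at infinity comparable to the power \<epsilon> - 2, so \<open>majorant\<close> dominates
    at each fixed \<delta>.\<close>
  let ?C = "2 * B * (1 + \<delta> powr (-(\<alpha> + \<epsilon>)))"
  have C0: "0 \<le> ?C" using B0 by simp
  have Fle: "\<bar>F \<xi>\<bar> \<le> ?C * min (norm \<xi> powr (\<epsilon> - 2)) (norm \<xi> powr (-(2 + \<alpha>)))" for \<xi>
  proof (cases "\<delta> < norm \<xi>")
    case True
    have 1: "\<bar>F \<xi>\<bar> \<le> 2 * B * norm \<xi> powr (-(2 + \<alpha>))"
      using B[of x] B[of "x + \<xi>"] True unfolding F_def abs_mult by (auto intro!: mult_right_mono)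
    have "norm \<xi> powr (-(2 + \<alpha>)) = norm \<xi> powr (-(\<alpha> + \<epsilon>)) * norm \<xi> powr (\<epsilon> - 2)"
      by (simp add: algebra_simps flip: powr_add)
    also have "\<dots> \<le> \<delta> powr (-(\<alpha> + \<epsilon>)) * norm \<xi> powr (\<epsilon> - 2)"
      using True \<delta> \<alpha> \<epsilon> by (intro mult_right_mono powr_mono2') auto
    also have "\<dots> \<le> (1 + \<delta> powr (-(\<alpha> + \<epsilon>))) * norm \<xi> powr (\<epsilon> - 2)"
      by (intro mult_right_mono) auto
    finally have "norm \<xi> powr (-(2 + \<alpha>)) \<le> (1 + \<delta> powr (-(\<alpha> + \<epsilon>))) * min (norm \<xi> powr (\<epsilon> - 2)) (norm \<xi> powr (-(2 + \<alpha>)))"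
      by (auto simp: min_def distrib_right)
    then have "2 * B * norm \<xi> powr (-(2 + \<alpha>)) \<le> 2 * B * ((1 + \<delta> powr (-(\<alpha> + \<epsilon>))) * min (norm \<xi> powr (\<epsilon> - 2)) (norm \<xi> powr (-(2 + \<alpha>))))"
      using B0 by (intro mult_left_mono) auto
    with 1 show ?thesis by (simp add: mult.assoc)
  next
    case False
    then show ?thesis using C0 by (simp add: F_def)
  qed
  have int: "integrable lborel (\<lambda>\<xi>. indicator quadrant \<xi> * F (?r m n \<xi>))" for m n :: nat
  proof (rule Bochner_Integration.integrable_bound)
    show "integrable lborel (\<lambda>\<xi>. ?C * majorant \<xi>)" using majorant_integrable by simp
    show "(\<lambda>\<xi>. indicator quadrant \<xi> * F (?r m n \<xi>)) \<in> borel_measurable lborel"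
      using measurable_compose[OF measurable_reflect F] by simp
    show "AE \<xi> in lborel. norm (indicat_real quadrant \<xi> * F (?r m n \<xi>)) \<le> norm (?C * majorant \<xi>)"
    proof (intro AE_I2)
      fix \<xi> :: "real \<times> real"
      have "norm (indicat_real quadrant \<xi> * F (?r m n \<xi>)) = indicat_real quadrant \<xi> * \<bar>F (?r m n \<xi>)\<bar>"
        by (simp add: abs_mult)
      also have "indicat_real quadrant \<xi> * \<bar>F (?r m n \<xi>)\<bar> \<le> indicat_real quadrant \<xi> * (?C * min (norm \<xi> powr (\<epsilon> - 2)) (norm \<xi> powr (-(2 + \<alpha>))))"
        using Fle[of "?r m n \<xi>"] unfolding nr by (intro mult_left_mono) auto
      also have "\<dots> = ?C * majorant \<xi>" by (simp add: majorant_def)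
      finally show "norm (indicat_real quadrant \<xi> * F (?r m n \<xi>)) \<le> norm (?C * majorant \<xi>)"
        by simp
    qed
  qed
  let ?G = "\<lambda>x'. (u x - u x') / dist x x' powr (2 + \<alpha>)"
  have FG: "F \<xi> = indicator {x'. \<delta> < dist x x'} (x + \<xi>) *\<^sub>R ?G (x + \<xi>)" for \<xi>
    unfolding F_def powr_minus by (simp add: indicator_def dist_norm divide_inverse)
  have GF: "indicator {x'. \<delta> < dist x x'} y *\<^sub>R ?G y = F (y - x)" for y
    by (simp add: FG)
  have trans: "integrable (distr lborel borel ((+) x)) (\<lambda>y. F (y - x))"
    using integral_fold_quadrant(2)[OF F int] by (subst integrable_distr_eq) auto
  have s: "set_integrable lborel {x'. \<delta> < dist x x'} ?G"
    unfolding set_integrable_def GF using trans by (simp add: lborel_distr_plus)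
  have "integral {x'. \<delta> < dist x x'} ?G = (LINT y|lborel. F (y - x))"
    using set_borel_integral_eq_integral(2)[OF s] unfolding set_lebesgue_integral_def GF by simp
  also have "\<dots> = (LINT y|distr lborel borel ((+) x). F (y - x))"
    by (simp add: lborel_distr_plus)
  also have "\<dots> = integral\<^sup>L lborel F"
    by (subst integral_distr) auto
  also have "\<dots> = (LINT \<xi>|lborel. indicator quadrant \<xi> * (\<Sum>m\<in>{0::nat,1}. \<Sum>n\<in>{0::nat,1}. F (?r m n \<xi>)))"
    by (rule integral_fold_quadrant(1)[OF F int])
  also have "\<dots> = (LINT \<xi>|lborel. - (indicator {\<xi>. \<delta> < norm \<xi>} \<xi> * (indicator quadrant \<xi> * (quad_diff u x \<xi> * norm \<xi> powr (-(2 + \<alpha>))))))"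
  proof (rule Bochner_Integration.integral_cong[OF refl])
    fix \<xi> :: "real \<times> real"
    have "F (?r m n \<xi>) = indicator {\<xi>. \<delta> < norm \<xi>} \<xi> * ((u x - u (fst x + (-1) ^ m * fst \<xi>, snd x + (-1) ^ n * snd \<xi>)) * norm \<xi> powr (-(2 + \<alpha>)))" for m n
      unfolding F_def nr by (simp add: indicator_def nr plus_prod_def)
    then show "indicat_real quadrant \<xi> * (\<Sum>m\<in>{0::nat,1}. \<Sum>n\<in>{0::nat,1}. F (?r m n \<xi>))
       = - (indicator {\<xi>. \<delta> < norm \<xi>} \<xi> * (indicator quadrant \<xi> * (quad_diff u x \<xi> * norm \<xi> powr (-(2 + \<alpha>)))))"
      by (simp only:) (simp add: quad_diff_def algebra_simps)
  qed
  finally show ?thesis by simp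
qed

text \<open>After folding, the kernel has an integrable majorant independent of the cut-off, so by
  dominated convergence the principal value is an ordinary integral.\<close>

lemma frac_lap_eq_integral_quadrant:
  "frac_lap \<alpha> u x = - frac_const 2 \<alpha> * integral quadrant (\<lambda>\<xi>. quad_diff u x \<xi> * norm \<xi> powr (-(2 + \<alpha>)))"
proof -
  let ?H = "\<lambda>\<xi>. indicator quadrant \<xi> * (quad_diff u x \<xi> * norm \<xi> powr (-(2 + \<alpha>)))"
  let ?I = "\<lambda>\<delta>. LINT \<xi>|lborel. indicator {\<xi>. \<delta> < norm \<xi>} \<xi> * ?H \<xi>"
  \<comment> \<open>The convergence theorem applied here is for limits at infinity, hence \<delta> =
    \<open>inverse t\<close>.\<close>
  have "((\<lambda>t. ?I (inverse t)) \<longlongrightarrow> integral\<^sup>L lborel ?H) at_top"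
  proof (rule integral_dominated_convergence_at_top)
    show "integrable lborel (\<lambda>\<xi>. (\<bar>K\<bar> + 8 * B) * majorant \<xi>)" using majorant_integrable by simp
    show "\<forall>\<^sub>F t in at_top. AE \<xi> in lborel. norm (indicator {\<xi>. inverse t < norm \<xi>} \<xi> * ?H \<xi>) \<le> (\<bar>K\<bar> + 8 * B) * majorant \<xi>"
    proof (intro always_eventually allI AE_I2)
      fix t :: real and \<xi> :: "real \<times> real"
      have "norm (indicator {\<xi>. inverse t < norm \<xi>} \<xi> * ?H \<xi>) \<le> norm (?H \<xi>)"
        by (simp add: indicator_def)
      also have "\<dots> \<le> (\<bar>K\<bar> + 8 * B) * majorant \<xi>"
        using kernel_le_majorant[of \<xi>] by (simp add: abs_mult)
      finally show "norm (indicator {\<xi>. inverse t < norm \<xi>} \<xi> * ?H \<xi>) \<le> (\<bar>K\<bar> + 8 * B) * majorant \<xi>" .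
    qed
    show "AE \<xi> in lborel. ((\<lambda>t. indicator {\<xi>. inverse t < norm \<xi>} \<xi> * ?H \<xi>) \<longlongrightarrow> ?H \<xi>) at_top"
    proof (intro AE_I2)
      fix \<xi> :: "real \<times> real"
      show "((\<lambda>t. indicator {\<xi>. inverse t < norm \<xi>} \<xi> * ?H \<xi>) \<longlongrightarrow> ?H \<xi>) at_top"
      \<comment> \<open>At the origin \<open>?H\<close> is 0 because \<open>0 powr a = 0\<close>;
        elsewhere the indicator is eventually 1.\<close>
      proof (cases "\<xi> = 0")
        case False
        have "\<forall>\<^sub>F t::real in at_top. inverse t < norm \<xi>"
          using tendsto_inverse_0_at_top[OF filterlim_ident] False by (intro order_tendstoD) auto
        then have "\<forall>\<^sub>F t in at_top. ?H \<xi> = indicator {\<xi>. inverse t < norm \<xi>} \<xi> * ?H \<xi>"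
          by eventually_elim simp
        then show ?thesis by (rule tendsto_eventually[OF eventually_mono]) simp
      qed simp
    qed
  qed measurable
  then have "(?I \<longlongrightarrow> integral\<^sup>L lborel ?H) (at_right 0)"
    by (simp add: filterlim_at_right_to_top)
  then have "((\<lambda>\<delta>. - ?I \<delta>) \<longlongrightarrow> - integral\<^sup>L lborel ?H) (at_right 0)"
    by (rule tendsto_minus)
  moreover have "\<forall>\<^sub>F \<delta> in at_right 0. - ?I \<delta> = integral {x'. \<delta> < dist x x'} (\<lambda>x'. (u x - u x') / dist x x' powr (2 + \<alpha>))"
    using eventually_at_right_less[of "0::real"] by eventually_elim (simp add: truncated_integral)
  ultimately have "((\<lambda>\<delta>. integral {x'. \<delta> < dist x x'} (\<lambda>x'. (u x - u x') / dist x x' powr (2 + \<alpha>))) \<longlongrightarrow> - integral\<^sup>L lborel ?H) (at_right 0)"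
    by (rule Lim_transform_eventually)
  then have "Lim (at_right 0) (\<lambda>\<delta>. integral {x'. \<delta> < dist x x'} (\<lambda>x'. (u x - u x') / dist x x' powr (2 + \<alpha>))) = - integral\<^sup>L lborel ?H"
    by (intro tendsto_Lim) simp
  moreover have "integral\<^sup>L lborel ?H = integral quadrant (\<lambda>\<xi>. quad_diff u x \<xi> * norm \<xi> powr (-(2 + \<alpha>)))"
    using set_borel_integral_eq_integral(2)[OF quad_diff_kernel_integrable] by (simp add: set_lebesgue_integral_def)
  ultimately show ?thesis unfolding frac_lap_def by simp
qed

end

subsection \<open>Second differences and the mesh\<close>

text \<open>The four shifted points form two antipodal pairs about \<open>x\<close>, given by \<xi>
  and its mirror image in the first axis, so bounds on even parts apply to each pair.\<close>

lemma quad_diff_eq: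
  "quad_diff u x \<xi> = (u (x + \<xi>) + u (x - \<xi>)) + (u (x + (fst \<xi>, - snd \<xi>)) + u (x - (fst \<xi>, - snd \<xi>))) - 4 * u x"
  by (cases x; cases \<xi>) (simp add: quad_diff_def)

lemma norm_conj: "norm (fst \<xi>, - snd \<xi>) = norm \<xi>" for \<xi> :: "real \<times> real"
  by (cases \<xi>) (simp add: norm_Pair)

lemma quad_diff_bounds:
  fixes u :: "real \<times> real \<Rightarrow> real"
  assumes u: "even_part_bound K \<sigma> u" and K: "0 \<le> K"
  shows "\<bar>quad_diff u x \<xi>\<bar> \<le> 4 * K * norm \<xi> powr \<sigma>"
    and "0 < d \<Longrightarrow> d \<le> r \<Longrightarrow> norm \<xi> \<le> r \<Longrightarrow> norm \<xi>' \<le> r \<Longrightarrow> norm (\<xi> - \<xi>') \<le> d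
      \<Longrightarrow> d * \<bar>quad_diff u x \<xi> - quad_diff u x \<xi>'\<bar> \<le> 4 * K * d powr \<sigma> * r"
    and "0 < d \<Longrightarrow> norm v \<le> d \<Longrightarrow>
      \<bar>quad_diff u x (c + v) + quad_diff u x (c - v) - 2 * quad_diff u x c\<bar> \<le> 4 * K * d powr \<sigma>"
proof -
  let ?b = "\<lambda>\<xi>::real\<times>real. (fst \<xi>, - snd \<xi>)"
  show "\<bar>quad_diff u x \<xi>\<bar> \<le> 4 * K * norm \<xi> powr \<sigma>"
  proof (cases "\<xi> = 0")
    case False
    then have n: "0 < norm \<xi>" by simp
    have 1: "\<bar>u (x + \<xi>) + u (x - \<xi>) - 2 * u x\<bar> \<le> K * norm \<xi> powr \<sigma>"
      using u n by (intro even_part_boundD0) auto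
    have 2: "\<bar>u (x + ?b \<xi>) + u (x - ?b \<xi>) - 2 * u x\<bar> \<le> K * norm \<xi> powr \<sigma>"
      using u n by (intro even_part_boundD0) (auto simp: norm_conj)
    have 3: "0 \<le> K * norm \<xi> powr \<sigma>" using K by simp
    show ?thesis unfolding quad_diff_eq using 1 2 3 by linarith
  qed (simp add: quad_diff_def)
  {
    assume d: "0 < d" "d \<le> r" "norm \<xi> \<le> r" "norm \<xi>' \<le> r" "norm (\<xi> - \<xi>') \<le> d"
    have 1: "d * \<bar>(u (x + \<xi>) + u (x - \<xi>)) - (u (x + \<xi>') + u (x - \<xi>'))\<bar> \<le> K * d powr \<sigma> * r"
      using u d by (intro even_part_boundD) auto
    have "norm (?b \<xi> - ?b \<xi>') \<le> d"
      using d norm_conj[of "\<xi> - \<xi>'"] by simp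
    then have 2: "d * \<bar>(u (x + ?b \<xi>) + u (x - ?b \<xi>)) - (u (x + ?b \<xi>') + u (x - ?b \<xi>'))\<bar> \<le> K * d powr \<sigma> * r"
      using u d by (intro even_part_boundD) (auto simp: norm_conj)
    have "\<bar>quad_diff u x \<xi> - quad_diff u x \<xi>'\<bar> \<le>
      \<bar>(u (x + \<xi>) + u (x - \<xi>)) - (u (x + \<xi>') + u (x - \<xi>'))\<bar> +
      \<bar>(u (x + ?b \<xi>) + u (x - ?b \<xi>)) - (u (x + ?b \<xi>') + u (x - ?b \<xi>'))\<bar>"
      unfolding quad_diff_eq by linarith
    then have "d * \<bar>quad_diff u x \<xi> - quad_diff u x \<xi>'\<bar> \<le>
      d * (\<bar>(u (x + \<xi>) + u (x - \<xi>)) - (u (x + \<xi>') + u (x - \<xi>'))\<bar> +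
      \<bar>(u (x + ?b \<xi>) + u (x - ?b \<xi>)) - (u (x + ?b \<xi>') + u (x - ?b \<xi>'))\<bar>)"
      using d by (intro mult_left_mono) auto
    then have "d * \<bar>quad_diff u x \<xi> - quad_diff u x \<xi>'\<bar> \<le> K * d powr \<sigma> * r + K * d powr \<sigma> * r"
      unfolding distrib_left using 1 2 by linarith
    moreover have "0 \<le> K * d powr \<sigma> * r" using K d by simp
    ultimately show "d * \<bar>quad_diff u x \<xi> - quad_diff u x \<xi>'\<bar> \<le> 4 * K * d powr \<sigma> * r" by linarith
  }
  {
    assume d: "0 < d" "norm v \<le> d"
    define D where "D = (\<lambda>p w. u (p + w) + u (p - w) - 2 * u p)"
    have D: "\<bar>D p w\<bar> \<le> K * d powr \<sigma>" if "norm w \<le> d" for p w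
      unfolding D_def using u d that by (intro even_part_boundD0) auto
    \<comment> \<open>The terms \<open>u x\<close> cancel, and the rest regroups into second
      differences of \<open>u\<close> at the four shifts of \<open>x\<close> by \<open>c\<close>.
      These four give the constant 4 K common to all three bounds.\<close>
    have "quad_diff u x (c + v) + quad_diff u x (c - v) - 2 * quad_diff u x c
        = D (x + c) v + D (x - c) v + D (x + ?b c) (?b v) + D (x - ?b c) (?b v)"
      unfolding quad_diff_eq D_def by (cases x; cases c; cases v) (simp add: algebra_simps)
    moreover have nb: "norm (?b v) \<le> d" using d by (simp add: norm_conj)
    ultimately show "\<bar>quad_diff u x (c + v) + quad_diff u x (c - v) - 2 * quad_diff u x c\<bar> \<le> 4 * K * d powr \<sigma>"
      using D[OF d(2), of "x + c"] D[OF d(2), of "x - c"]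
        D[OF nb, of "x + ?b c"] D[OF nb, of "x - ?b c"] by linarith
  }
qed

section \<open>Decomposition of the quadrant and summation over cells\<close>

lemma interval_in_mesh:
  fixes t h :: real
  assumes "0 \<le> t" "t \<le> real N * h" "0 < N"
  shows "\<exists>i<N. real i * h \<le> t \<and> t \<le> real (i + 1) * h"
  using assms
proof (induction N)
  case (Suc n)
  show ?case
  proof (cases "n > 0 \<and> t \<le> real n * h")
    case True
    then show ?thesis using Suc.IH Suc.prems less_SucI by blast
  next
    case False
    then show ?thesis using Suc.prems by (intro exI[of _ n]) auto
  qed
qed simp

text \<open>Two closed mesh intervals with different indices share at most the point
  \<open>max i j * h\<close>, so distinct cells meet inside one mesh line.\<close>

lemma negligible_cell_Int:
  assumes h: "0 < h" and ne: "(i, j) \<noteq> (i', j')"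
  shows "negligible (cell h i j \<inter> cell h i' j')"
proof -
  have b: "(1, 0) \<in> (Basis :: (real \<times> real) set)" "(0, 1) \<in> (Basis :: (real \<times> real) set)"
    by (auto simp: Basis_prod_def)
  have eq: "t = real (max i j) * h" if "i \<noteq> j" "real i * h \<le> t" "t \<le> real (i + 1) * h" "real j * h \<le> t" "t \<le> real (j + 1) * h"
    for i j :: nat and t
  proof (cases "i < j")
    case True
    then have "real (i + 1) * h \<le> real j * h" using h by (intro mult_right_mono) auto
    then show ?thesis using that True by (simp add: max_def)
  next
    case False
    then have "real (j + 1) * h \<le> real i * h" using h that by (intro mult_right_mono) auto
    then show ?thesis using that False by (simp add: max_def)
  qed
  show ?thesis
  proof (cases "i = i'")
    case False
    then have "cell h i j \<inter> cell h i' j' \<subseteq> {\<xi>. \<xi> \<bullet> (1, 0) = real (max i i') * h}"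
      using eq by (fastforce simp: mem_cell inner_prod_def)
    then show ?thesis using negligible_standard_hyperplane[OF b(1)] negligible_subset by blast
  next
    case True
    then have "cell h i j \<inter> cell h i' j' \<subseteq> {\<xi>. \<xi> \<bullet> (0, 1) = real (max j j') * h}"
      using eq ne by (fastforce simp: mem_cell inner_prod_def)
    then show ?thesis using negligible_standard_hyperplane[OF b(2)] negligible_subset by blast
  qed
qed

lemma integral_quadrant_eq_sum_cells:
  fixes H :: "real \<times> real \<Rightarrow> real"
  assumes H: "set_integrable lborel quadrant H" and N: "0 < N" and L: "0 < L" and h: "h = L / real N"
  shows "integral quadrant H = (\<Sum>(i, j)\<in>{0..<N} \<times> {0..<N}. integral (cell h i j) H) + integral (D2 L) H"
proof -
  have h0: "0 < h" using N L h by simp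
  have Nh: "real N * h = L" using N h by simp
  have sub: "H integrable_on S" if "S \<in> sets borel" "S \<subseteq> quadrant" for S
    using set_borel_integral_eq_integral(1) set_integrable_subset[OF H] that by auto
  have cell_sub: "cell h i j \<subseteq> quadrant" for i j
    using h0 by (auto simp: mem_cell intro: order_trans[rotated])
  have cells: "(H has_integral (\<Sum>ij\<in>{0..<N} \<times> {0..<N}. integral (cell h (fst ij) (snd ij)) H))
      (\<Union>ij\<in>{0..<N} \<times> {0..<N}. cell h (fst ij) (snd ij))"
  proof (rule has_integral_UN)
    show "(H has_integral integral (cell h (fst ij) (snd ij)) H) (cell h (fst ij) (snd ij))" for ij
      using cell_sub by (intro integrable_integral sub) (auto simp: cell_def)
    show "pairwise (\<lambda>ij ij'. negligible (cell h (fst ij) (snd ij) \<inter> cell h (fst ij') (snd ij'))) ({0..<N} \<times> {0..<N})"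
      using negligible_cell_Int[OF h0] by (auto simp: pairwise_def)
  qed simp
  have U: "(\<Union>ij\<in>{0..<N} \<times> {0..<N}. cell h (fst ij) (snd ij)) = cbox (0, 0) (L, L)"
  proof (intro equalityI subsetI)
    fix \<xi> assume "\<xi> \<in> (\<Union>ij\<in>{0..<N} \<times> {0..<N}. cell h (fst ij) (snd ij))"
    then obtain i j where ij: "i < N" "j < N" "\<xi> \<in> cell h i j" by auto
    have "real (i + 1) * h \<le> L" "real (j + 1) * h \<le> L"
      unfolding Nh[symmetric] using ij h0 by (auto intro!: mult_right_mono)
    moreover have "0 \<le> real i * h" "0 \<le> real j * h" using h0 by auto
    ultimately have "0 \<le> fst \<xi>" "0 \<le> snd \<xi>" "fst \<xi> \<le> L" "snd \<xi> \<le> L"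
      using ij(3) unfolding mem_cell by linarith+
    then show "\<xi> \<in> cbox (0, 0) (L, L)" by (cases \<xi>) (auto simp: cbox_Pair_eq)
  next
    fix \<xi> assume "\<xi> \<in> cbox (0, 0) (L, L)"
    then have *: "0 \<le> fst \<xi>" "fst \<xi> \<le> real N * h" "0 \<le> snd \<xi>" "snd \<xi> \<le> real N * h"
      unfolding Nh by (cases \<xi>; auto simp: cbox_Pair_eq)+
    obtain i where i: "i < N" "real i * h \<le> fst \<xi>" "fst \<xi> \<le> real (i + 1) * h"
      using interval_in_mesh[OF *(1,2) N] by blast
    obtain j where j: "j < N" "real j * h \<le> snd \<xi>" "snd \<xi> \<le> real (j + 1) * h"
      using interval_in_mesh[OF *(3,4) N] by blast
    have "\<xi> \<in> cell h i j" using i j unfolding mem_cell by blast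
    then show "\<xi> \<in> (\<Union>ij\<in>{0..<N} \<times> {0..<N}. cell h (fst ij) (snd ij))"
      using i(1) j(1) by force
  qed
  have D2: "(H has_integral integral (D2 L) H) (D2 L)"
    by (intro integrable_integral sub) (auto simp: D2_def)
  \<comment> \<open>\<open>D2 L\<close> omits only the open square and so contains its boundary; the
    overlap with the closed square is that boundary.\<close>
  have neg: "negligible (cbox (0, 0) (L, L) \<inter> D2 L)"
    by (rule negligible_subset[OF negligible_frontier_interval[of "(0::real, 0::real)" "(L, L)"]])
       (auto simp: D2_def)
  have "cbox (0, 0) (L, L) \<union> D2 L = quadrant"
    using box_subset_cbox[of "(0::real, 0::real)" "(L, L)"] by (auto simp: D2_def cbox_Pair_eq)
  then have "(H has_integral ((\<Sum>ij\<in>{0..<N} \<times> {0..<N}. integral (cell h (fst ij) (snd ij)) H) + integral (D2 L) H)) quadrant"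
    using has_integral_Un[OF cells[unfolded U] D2 neg] by simp
  then show ?thesis by (simp add: integral_unique case_prod_beta)
qed

text \<open>Off the index (0, 0) the maximum is at least (i + 1)/2 and at least (j + 1)/2. Half of
  the exponent goes to each index, which separates the double sum into two series with exponent 1 +
  \<alpha>/2 > 1 and gives a bound uniform in \<open>N\<close>.\<close>

lemma sum_max_powr_bounded:
  assumes "0 < \<alpha>"
  obtains S where "0 \<le> S"
    "\<And>N. (\<Sum>(i, j)\<in>{0..<N} \<times> {0..<N} - {(0, 0)}. real (max i j) powr (-(2 + \<alpha>))) \<le> S"
proof -
  define p where "p = 1 + \<alpha> / 2"
  define f where "f = (\<lambda>i. real (Suc i) powr (-p))"
  have "summable (\<lambda>n. real n powr (-p))"
    using assms by (simp add: summable_real_powr_iff p_def)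
  then have sf: "summable f" unfolding f_def by (subst summable_Suc_iff)
  have f0: "0 \<le> f i" for i by (simp add: f_def)
  have le: "real (max i j) powr (-(2 + \<alpha>)) \<le> 2 powr (2 + \<alpha>) * (f i * f j)" if "(i, j) \<noteq> (0, 0)" for i j
  proof -
    let ?m = "real (max i j)"
    have m: "0 < ?m" "real (Suc i) / 2 \<le> ?m" "real (Suc j) / 2 \<le> ?m" using that by (auto simp: max_def)
    have p0: "0 \<le> p" using assms by (simp add: p_def)
    have "?m powr (-(2 + \<alpha>)) = ?m powr (-p) * ?m powr (-p)"
      by (simp add: p_def flip: powr_add)
    also have "\<dots> \<le> (real (Suc i) / 2) powr (-p) * (real (Suc j) / 2) powr (-p)"
      using m p0 by (intro mult_mono powr_mono2') auto
    also have "\<dots> = (2 powr p * 2 powr p) * (f i * f j)"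
      by (simp add: f_def powr_divide powr_minus field_simps)
    also have "2 powr p * 2 powr p = (2::real) powr (2 + \<alpha>)"
      by (simp add: p_def flip: powr_add)
    finally show ?thesis .
  qed
  have "(\<Sum>(i, j)\<in>{0..<N} \<times> {0..<N} - {(0, 0)}. real (max i j) powr (-(2 + \<alpha>))) \<le> 2 powr (2 + \<alpha>) * (suminf f * suminf f)" for N
  proof -
    have "(\<Sum>(i, j)\<in>{0..<N} \<times> {0..<N} - {(0, 0)}. real (max i j) powr (-(2 + \<alpha>)))
        \<le> (\<Sum>(i, j)\<in>{0..<N} \<times> {0..<N} - {(0, 0)}. 2 powr (2 + \<alpha>) * (f i * f j))"
    proof (rule sum_mono)
      show "(case z of (i, j) \<Rightarrow> real (max i j) powr (-(2 + \<alpha>))) \<le> (case z of (i, j) \<Rightarrow> 2 powr (2 + \<alpha>) * (f i * f j))"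
        if "z \<in> {0..<N} \<times> {0..<N} - {(0, 0)}" for z
        using that le[of "fst z" "snd z"] by (cases z) auto
    qed
    also have "\<dots> \<le> (\<Sum>(i, j)\<in>{0..<N} \<times> {0..<N}. 2 powr (2 + \<alpha>) * (f i * f j))"
      using f0 by (intro sum_mono2) auto
    also have "\<dots> = 2 powr (2 + \<alpha>) * ((\<Sum>i\<in>{0..<N}. f i) * (\<Sum>j\<in>{0..<N}. f j))"
      by (subst sum_product) (simp only: sum_distrib_left sum.cartesian_product case_prod_unfold)
    also have "\<dots> \<le> 2 powr (2 + \<alpha>) * (suminf f * suminf f)"
      using sf f0 by (intro mult_left_mono mult_mono sum_le_suminf sum_nonneg suminf_nonneg) auto
    finally show ?thesis .
  qed
  then show thesis
    using suminf_nonneg[OF sf f0] by (intro that[of "2 powr (2 + \<alpha>) * (suminf f * suminf f)"]) auto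
qed

subsection \<open>The error estimate\<close>

text \<open>One coordinate of \<xi> is at least L, hence at least the side of the rectangle in that
  direction, and every shift leaves it. The axes are excluded because points such as (0, t) with
  small t > 0 belong to \<open>D2 L\<close> although their shifts may stay inside.\<close>

lemma quad_diff_outside_domain:
  assumes u: "\<forall>p. p \<notin> box (a_x, a_y) (b_x, b_y) \<longrightarrow> u p = 0"
    and L: "b_x - a_x \<le> L" "b_y - a_y \<le> L" and x: "x \<in> box (a_x, a_y) (b_x, b_y)"
    and \<xi>: "\<xi> \<in> D2 L" "fst \<xi> \<noteq> 0" "snd \<xi> \<noteq> 0"
  shows "quad_diff u x \<xi> = - 4 * u x"
proof -
  have mb: "p \<in> box (a, a') (b, b') \<longleftrightarrow> a < fst p \<and> fst p < b \<and> a' < snd p \<and> snd p < b'"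
    for p :: "real \<times> real" and a b a' b' :: real
    by (auto simp: mem_box Basis_prod_def inner_prod_def)
  have far: "L \<le> fst \<xi> \<or> L \<le> snd \<xi>" "0 < fst \<xi>" "0 < snd \<xi>"
    using \<xi> unfolding D2_def by (auto simp: mb not_less)
  have "u (fst x + (-1) ^ m * fst \<xi>, snd x + (-1) ^ n * snd \<xi>) = 0" for m n :: nat
  proof -
    have "(-1) ^ k * t = t \<or> (-1) ^ k * t = - t" for k :: nat and t :: real
      by (cases "even k") simp_all
    from this[of m "fst \<xi>"] this[of n "snd \<xi>"]
    have "(fst x + (-1) ^ m * fst \<xi>, snd x + (-1) ^ n * snd \<xi>) \<notin> box (a_x, a_y) (b_x, b_y)"
      using far L x unfolding mb by auto
    then show ?thesis using u by blast
  qed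
  then show ?thesis by (simp only: quad_diff_def) simp
qed

lemma negligible_axes: "negligible {\<xi>::real \<times> real. fst \<xi> = 0 \<or> snd \<xi> = 0}"
proof -
  have b: "(1, 0) \<in> (Basis :: (real \<times> real) set)" "(0, 1) \<in> (Basis :: (real \<times> real) set)"
    by (auto simp: Basis_prod_def)
  have "{\<xi>::real \<times> real. fst \<xi> = 0 \<or> snd \<xi> = 0} = {\<xi>. \<xi> \<bullet> (1, 0) = 0} \<union> {\<xi>. \<xi> \<bullet> (0, 1) = 0}"
    by (auto simp: inner_prod_def)
  then show ?thesis using negligible_standard_hyperplane[OF b(1)] negligible_standard_hyperplane[OF b(2)] by auto
qed

text \<open>The floor is 0 or 1, and the order of differentiation plus the Hoelder exponent is
  \<alpha> + \<epsilon> in both cases, so the distinction ends here.\<close>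

lemma holder_space_even_part_bound:
  assumes "u \<in> holder_space (nat \<lfloor>\<alpha>\<rfloor>) (\<alpha> - of_int \<lfloor>\<alpha>\<rfloor> + \<epsilon>)"
    and "0 < \<alpha>" "\<alpha> < 2" "0 < \<epsilon>" "\<epsilon> \<le> 1 + of_int \<lfloor>\<alpha>\<rfloor> - \<alpha>"
  obtains K where "0 \<le> K" "even_part_bound K (\<alpha> + \<epsilon>) u"
proof (cases "\<alpha> < 1")
  case True
  then have "\<lfloor>\<alpha>\<rfloor> = 0" using assms by (simp add: floor_unique)
  then show ?thesis using holder_space_even_part_bound_0[of u "\<alpha> + \<epsilon>"] assms that by auto
next
  case False
  then have f: "\<lfloor>\<alpha>\<rfloor> = 1" using assms by (intro floor_unique) auto
  then have "u \<in> holder_space 1 (\<alpha> - 1 + \<epsilon>)" using assms by simp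
  then show ?thesis
    using holder_space_even_part_bound_1[of u "\<alpha> - 1 + \<epsilon>"] assms f False that by (auto simp: algebra_simps)
qed

lemma holder_space_continuous: "u \<in> holder_space k s \<Longrightarrow> continuous_on UNIV u"
proof -
  assume "u \<in> holder_space k s"
  then have "set [] \<subseteq> (Basis::(real\<times>real) set) \<and> length ([]::(real\<times>real) list) \<le> k \<longrightarrow> continuous_on UNIV (iter_pd [] u)"
    unfolding holder_space_def by blast
  then show ?thesis by simp
qed

lemma bounded_of_compact_support:
  fixes u :: "'a::euclidean_space \<Rightarrow> real"
  assumes "continuous_on UNIV u" "\<forall>p. p \<notin> box a b \<longrightarrow> u p = 0"
  obtains B where "\<And>p. \<bar>u p\<bar> \<le> B"
proof -
  have "compact (u ` cbox a b)"
    using assms by (intro compact_continuous_image continuous_on_subset[OF assms(1)]) auto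
  then have "bounded (u ` cbox a b)" by (rule compact_imp_bounded)
  then obtain B where B: "\<And>p. p \<in> cbox a b \<Longrightarrow> \<bar>u p\<bar> \<le> B"
    unfolding bounded_iff by auto
  have "\<bar>u p\<bar> \<le> max B 0" for p
    using B[of p] assms(2) box_subset_cbox[of a b] by (cases "p \<in> cbox a b") auto
  then show thesis using that by blast
qed

text \<open>The kernel is bounded by K times the norm to the power \<epsilon> - 2. The corner values
  have size h^(\<alpha>+\<epsilon>-\<gamma>) and multiply a weight integral of size
  h^(\<gamma>-\<alpha>), so \<gamma> cancels from the exponent.\<close>

lemma cell00_error:
  fixes u :: "real \<times> real \<Rightarrow> real"
  assumes h: "0 < h" and K: "0 \<le> K" and \<alpha>: "0 < \<alpha>" and \<epsilon>: "0 < \<epsilon>" "\<epsilon> \<le> 2" "\<alpha> + \<epsilon> \<le> 2" and \<gamma>: "\<alpha> < \<gamma>" "\<gamma> \<le> 2"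
    and g: "\<And>\<xi>. \<bar>quad_diff u x \<xi>\<bar> \<le> K * norm \<xi> powr (\<alpha> + \<epsilon>)"
    and int: "(\<lambda>\<xi>. quad_diff u x \<xi> * norm \<xi> powr (-(2 + \<alpha>))) integrable_on cell h 0 0"
  shows "\<bar>integral (cell h 0 0) (\<lambda>\<xi>. quad_diff u x \<xi> * norm \<xi> powr (-(2 + \<alpha>)))
      - 1/4 * (coef \<gamma> 1 0 * psi \<gamma> u x (grid_pt h 1 0) + coef \<gamma> 0 1 * psi \<gamma> u x (grid_pt h 0 1)
             + coef \<gamma> 1 1 * psi \<gamma> u x (grid_pt h 1 1)) * integral (cell h 0 0) (omega \<alpha> \<gamma>)\<bar>
    \<le> ((2 / \<epsilon>)\<^sup>2 + 6 * (2 / (\<gamma> - \<alpha>))\<^sup>2) * K * h powr \<epsilon>"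
proof -
  have "\<bar>integral (cell h 0 0) (\<lambda>\<xi>. quad_diff u x \<xi> * norm \<xi> powr (-(2 + \<alpha>)))\<bar>
      \<le> integral (cell h 0 0) (\<lambda>\<xi>. K * norm \<xi> powr (\<epsilon> - 2))"
    unfolding real_norm_def[symmetric]
  proof (rule integral_norm_bound_integral[OF int])
    show "(\<lambda>\<xi>. K * norm \<xi> powr (\<epsilon> - 2)) integrable_on cell h 0 0"
      using set_borel_integral_eq_integral(1)[OF integral_norm_powr_cell00(1)[of \<epsilon> h]] \<epsilon> h
      by (intro integrable_on_mult_right) auto
    fix \<xi> :: "real \<times> real"
    have "norm (quad_diff u x \<xi> * norm \<xi> powr (-(2 + \<alpha>))) \<le> K * norm \<xi> powr (\<alpha> + \<epsilon>) * norm \<xi> powr (-(2 + \<alpha>))"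
      using g[of \<xi>] by (auto simp: abs_mult intro: mult_right_mono)
    then show "norm (quad_diff u x \<xi> * norm \<xi> powr (-(2 + \<alpha>))) \<le> K * norm \<xi> powr (\<epsilon> - 2)"
      by (simp add: mult.assoc flip: powr_add)
  qed
  also have "\<dots> = K * integral (cell h 0 0) (\<lambda>\<xi>. norm \<xi> powr (\<epsilon> - 2))" by simp
  also have "\<dots> \<le> K * ((2 / \<epsilon>)\<^sup>2 * h powr \<epsilon>)"
    using \<epsilon> h K by (intro mult_left_mono integral_norm_powr_cell00(2)) auto
  finally have 1: "\<bar>integral (cell h 0 0) (\<lambda>\<xi>. quad_diff u x \<xi> * norm \<xi> powr (-(2 + \<alpha>)))\<bar> \<le> K * ((2 / \<epsilon>)\<^sup>2 * h powr \<epsilon>)" .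
  \<comment> \<open>The 8 is 2 * 4: coefficients are at most 2 for either kind of \<gamma>, and (2
    h)^(\<alpha>+\<epsilon>) costs at most 4.\<close>
  have psi: "\<bar>coef \<gamma> m n * psi \<gamma> u x \<xi>\<bar> \<le> 8 * K * h powr (\<alpha> + \<epsilon> - \<gamma>)" if "h \<le> norm \<xi>" "norm \<xi> \<le> 2 * h" for m n \<xi>
  proof -
    have "2 powr (\<alpha> + \<epsilon>) \<le> (2::real) powr 2" using \<epsilon> by (intro powr_mono) auto
    then have "(2 * h) powr (\<alpha> + \<epsilon>) \<le> 4 * h powr (\<alpha> + \<epsilon>)"
      using h by (simp add: powr_mult powr_numeral mult_right_mono)
    moreover have "norm \<xi> powr (\<alpha> + \<epsilon>) \<le> (2 * h) powr (\<alpha> + \<epsilon>)"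
      using that \<alpha> \<epsilon> by (intro powr_mono2) auto
    ultimately have "K * norm \<xi> powr (\<alpha> + \<epsilon>) \<le> K * (4 * h powr (\<alpha> + \<epsilon>))"
      using K by (intro mult_left_mono) auto
    with g[of \<xi>] have "\<bar>quad_diff u x \<xi>\<bar> \<le> K * (4 * h powr (\<alpha> + \<epsilon>))" by linarith
    moreover have "norm \<xi> powr (-\<gamma>) \<le> h powr (-\<gamma>)"
      using that h \<gamma> \<alpha> by (intro powr_mono2') auto
    ultimately have "\<bar>psi \<gamma> u x \<xi>\<bar> \<le> h powr (-\<gamma>) * (K * (4 * h powr (\<alpha> + \<epsilon>)))"
      unfolding psi_eq_quad_diff abs_mult by (intro mult_mono) auto
    also have "\<dots> = 4 * K * h powr (\<alpha> + \<epsilon> - \<gamma>)"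
      by (simp add: powr_diff powr_minus divide_inverse mult_ac)
    finally have "\<bar>coef \<gamma> m n\<bar> * \<bar>psi \<gamma> u x \<xi>\<bar> \<le> 2 * (4 * K * h powr (\<alpha> + \<epsilon> - \<gamma>))"
      by (intro mult_mono) (auto simp: coef_def)
    then show ?thesis by (simp add: abs_mult)
  qed
  have n: "norm (grid_pt h 1 0) = h" "norm (grid_pt h 0 1) = h" "norm (grid_pt h 1 1) = h * sqrt 2"
    using h real_sqrt_mult[of 2 "h\<^sup>2"] by (simp_all add: grid_pt_def norm_Pair mult.commute)
  have s2: "1 \<le> sqrt 2" "sqrt 2 \<le> 2" by (auto simp: real_le_lsqrt)
  let ?\<Sigma> = "coef \<gamma> 1 0 * psi \<gamma> u x (grid_pt h 1 0) + coef \<gamma> 0 1 * psi \<gamma> u x (grid_pt h 0 1)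
             + coef \<gamma> 1 1 * psi \<gamma> u x (grid_pt h 1 1)"
  \<comment> \<open>Three corners with bound 8 each, times 1/4.\<close>
  have \<Sigma>: "\<bar>1/4 * ?\<Sigma>\<bar> \<le> 6 * K * h powr (\<alpha> + \<epsilon> - \<gamma>)"
  proof -
    have "\<bar>coef \<gamma> 1 1 * psi \<gamma> u x (grid_pt h 1 1)\<bar> \<le> 8 * K * h powr (\<alpha> + \<epsilon> - \<gamma>)"
      using h s2 by (intro psi) (auto simp: n[simplified])
    moreover have "\<bar>coef \<gamma> 1 0 * psi \<gamma> u x (grid_pt h 1 0)\<bar> \<le> 8 * K * h powr (\<alpha> + \<epsilon> - \<gamma>)"
      "\<bar>coef \<gamma> 0 1 * psi \<gamma> u x (grid_pt h 0 1)\<bar> \<le> 8 * K * h powr (\<alpha> + \<epsilon> - \<gamma>)"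
      using h by (intro psi; simp add: n[simplified])+
    ultimately show ?thesis unfolding distrib_left by linarith
  qed
  \<comment> \<open>With p = \<gamma> - \<alpha> the assumption \<alpha> < \<gamma> is exactly
    integrability of the weight at the origin.\<close>
  have w: "omega \<alpha> \<gamma> = (\<lambda>\<xi>. norm \<xi> powr ((\<gamma> - \<alpha>) - 2))" by (auto simp: omega_def algebra_simps)
  have W: "integral (cell h 0 0) (omega \<alpha> \<gamma>) \<le> (2 / (\<gamma> - \<alpha>))\<^sup>2 * h powr (\<gamma> - \<alpha>)"
    unfolding w using \<gamma> \<alpha> h by (intro integral_norm_powr_cell00(2)) auto
  have W0: "0 \<le> integral (cell h 0 0) (omega \<alpha> \<gamma>)"
    unfolding w using set_borel_integral_eq_integral(1)[OF integral_norm_powr_cell00(1)[of "\<gamma> - \<alpha>" h]] \<gamma> \<alpha> h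
    by (intro integral_nonneg) auto
  have "\<bar>1/4 * ?\<Sigma> * integral (cell h 0 0) (omega \<alpha> \<gamma>)\<bar>
      \<le> (6 * K * h powr (\<alpha> + \<epsilon> - \<gamma>)) * ((2 / (\<gamma> - \<alpha>))\<^sup>2 * h powr (\<gamma> - \<alpha>))"
    unfolding abs_mult[of "1/4 * ?\<Sigma>"] using \<Sigma> W W0 K by (intro mult_mono) auto
  also have "\<dots> = 6 * K * (2 / (\<gamma> - \<alpha>))\<^sup>2 * (h powr (\<alpha> + \<epsilon> - \<gamma>) * h powr (\<gamma> - \<alpha>))" by simp
  also have "h powr (\<alpha> + \<epsilon> - \<gamma>) * h powr (\<gamma> - \<alpha>) = h powr \<epsilon>" by (simp flip: powr_add)
  finally have 2: "\<bar>1/4 * ?\<Sigma> * integral (cell h 0 0) (omega \<alpha> \<gamma>)\<bar> \<le> 6 * K * (2 / (\<gamma> - \<alpha>))\<^sup>2 * h powr \<epsilon>" .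
  have "((2 / \<epsilon>)\<^sup>2 + 6 * (2 / (\<gamma> - \<alpha>))\<^sup>2) * K * h powr \<epsilon> = K * ((2 / \<epsilon>)\<^sup>2 * h powr \<epsilon>) + 6 * K * (2 / (\<gamma> - \<alpha>))\<^sup>2 * h powr \<epsilon>"
    by (simp add: algebra_simps)
  with 1 2 show ?thesis by linarith
qed

theorem theorem1:
  fixes \<alpha> \<gamma> \<epsilon> a_x b_x a_y b_y :: real and u :: "real \<times> real \<Rightarrow> real"
  assumes "0 < \<alpha>" "\<alpha> < 2"
    and "a_x < b_x" "a_y < b_y"
    and "\<forall>p. p \<notin> box (a_x, a_y) (b_x, b_y) \<longrightarrow> u p = 0"
    and "0 < \<epsilon>" "\<epsilon> \<le> 1 + of_int \<lfloor>\<alpha>\<rfloor> - \<alpha>"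
    and "u \<in> holder_space (nat \<lfloor>\<alpha>\<rfloor>) (\<alpha> - of_int \<lfloor>\<alpha>\<rfloor> + \<epsilon>)"
    and "\<alpha> < \<gamma>" "\<gamma> \<le> 2"
  shows "\<exists>C > 0. \<exists>N0::nat. \<forall>N \<ge> N0.
           \<forall>x \<in> box (a_x, a_y) (b_x, b_y).
             \<bar>frac_lap \<alpha> u x - disc_frac_lap \<alpha> \<gamma> (max (b_x - a_x) (b_y - a_y)) N u x\<bar>
               \<le> C * (max (b_x - a_x) (b_y - a_y) / real N) powr \<epsilon>"
proof -
  define L where "L = max (b_x - a_x) (b_y - a_y)"
  have L: "0 < L" "b_x - a_x \<le> L" "b_y - a_y \<le> L" using assms(3,4) by (auto simp: L_def)
  define \<sigma> where "\<sigma> = \<alpha> + \<epsilon>"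
  \<comment> \<open>The restriction on \<epsilon> gives \<sigma> \<le> 1 + floor \<alpha> \<le> 2,
    the range in which second differences are controlled.\<close>
  have "of_int \<lfloor>\<alpha>\<rfloor> \<le> (1::real)" using assms(2) by (simp add: floor_le_iff)
  then have \<sigma>: "0 \<le> \<sigma>" "\<sigma> \<le> 2" "\<alpha> + \<epsilon> \<le> 2" using assms(1,6,7) unfolding \<sigma>_def by linarith+
  have \<epsilon>2: "\<epsilon> \<le> 2" using \<sigma>(3) assms(1) by linarith
  obtain K0 where K0: "0 \<le> K0" "even_part_bound K0 (\<alpha> + \<epsilon>) u"
    using holder_space_even_part_bound[OF assms(8,1,2,6,7)] .
  define K where "K = 4 * K0"
  have K: "0 \<le> K" using K0 by (simp add: K_def)
  note qd = quad_diff_bounds[OF K0(2,1), folded K_def]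
  have cont: "continuous_on UNIV u" using assms(8) by (rule holder_space_continuous)
  obtain B where B: "\<And>p. \<bar>u p\<bar> \<le> B"
    using bounded_of_compact_support[OF cont assms(5)] by blast
  obtain S where S: "0 \<le> S"
    "\<And>N. (\<Sum>(i, j)\<in>{0..<N} \<times> {0..<N} - {(0, 0)}. real (max i j) powr (-(2 + \<alpha>))) \<le> S"
    using sum_max_powr_bounded[OF assms(1)] by blast
  define C1 where "C1 = ((2 / \<epsilon>)\<^sup>2 + 6 * (2 / (\<gamma> - \<alpha>))\<^sup>2) * K"
  define C2 where "C2 = ((1 + 8 * \<gamma> + 16 * (\<gamma> + 49 * (\<gamma> * (\<gamma> / 2 + 1)))) + (2 + \<alpha> - \<gamma>) * (8 + 32 * \<gamma>)) * K"
  have C12: "0 \<le> C1" "0 \<le> C2" using K assms(1,9,10) by (auto simp: C1_def C2_def)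
  \<comment> \<open>All ingredients are independent of \<open>x\<close> and \<open>N\<close>; the
    summand 1 keeps \<open>C\<close> positive even if \<open>C1\<close> and \<open>C2\<close>
    vanish.\<close>
  define C where "C = \<bar>frac_const 2 \<alpha>\<bar> * (C1 + C2 * S) + 1"
  have C: "0 < C" using C12 S by (simp add: C_def add_nonneg_pos)
  have main: "\<bar>frac_lap \<alpha> u x - disc_frac_lap \<alpha> \<gamma> L N u x\<bar> \<le> C * (L / real N) powr \<epsilon>"
    if N: "1 \<le> N" and x: "x \<in> box (a_x, a_y) (b_x, b_y)" for N x
  proof -
    define h where "h = L / real N"
    have h: "0 < h" using L N by (simp add: h_def)
    define H where "H = (\<lambda>\<xi>. quad_diff u x \<xi> * norm \<xi> powr (-(2 + \<alpha>)))"
    have Hint: "set_integrable lborel quadrant H"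
      unfolding H_def using quad_diff_kernel_integrable[OF assms(1,6) \<epsilon>2 cont B qd(1)] .
    have lap: "frac_lap \<alpha> u x = - frac_const 2 \<alpha> * integral quadrant H"
      unfolding H_def using frac_lap_eq_integral_quadrant[OF assms(1,6) \<epsilon>2 cont B qd(1)] .
    let ?J = "{0..<N} \<times> {0..<N} - {(0::nat, 0::nat)}"
    let ?T = "\<lambda>i j. 1/4 * ((\<Sum>m\<in>{0::nat,1}. \<Sum>n\<in>{0::nat,1}. psi \<gamma> u x (grid_pt h (i + m) (j + n)))
            * integral (cell h i j) (omega \<alpha> \<gamma>))"
    let ?Z = "1/4 * (coef \<gamma> 1 0 * psi \<gamma> u x (grid_pt h 1 0) + coef \<gamma> 0 1 * psi \<gamma> u x (grid_pt h 0 1)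
             + coef \<gamma> 1 1 * psi \<gamma> u x (grid_pt h 1 1)) * integral (cell h 0 0) (omega \<alpha> \<gamma>)"
    have HD2: "integral (D2 L) H = - (4 * u x * integral (D2 L) (\<lambda>\<xi>. norm \<xi> powr (-(2 + \<alpha>))))"
    proof -
      have "integral (D2 L) H = integral (D2 L) (\<lambda>\<xi>. (- 4 * u x) * norm \<xi> powr (-(2 + \<alpha>)))"
      proof (rule integral_spike[OF negligible_axes])
        fix \<xi> assume "\<xi> \<in> D2 L - {\<xi>. fst \<xi> = 0 \<or> snd \<xi> = 0}"
        then have "quad_diff u x \<xi> = - 4 * u x"
          by (intro quad_diff_outside_domain[OF assms(5) L(2,3) x]) auto
        then show "(- 4 * u x) * norm \<xi> powr (-(2 + \<alpha>)) = H \<xi>" by (simp add: H_def)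
      qed
      also have "\<dots> = (- 4 * u x) * integral (D2 L) (\<lambda>\<xi>. norm \<xi> powr (-(2 + \<alpha>)))"
        by (rule integral_mult_right)
      finally show ?thesis by simp
    qed
    have "integral quadrant H = (\<Sum>(i, j)\<in>{0..<N} \<times> {0..<N}. integral (cell h i j) H) + integral (D2 L) H"
      using N by (intro integral_quadrant_eq_sum_cells[OF Hint _ L(1) h_def]) auto
    also have "(\<Sum>(i, j)\<in>{0..<N} \<times> {0..<N}. integral (cell h i j) H)
        = integral (cell h 0 0) H + (\<Sum>(i, j)\<in>?J. integral (cell h i j) H)"
      using N by (subst sum.remove[of _ "(0, 0)"]) auto
    finally have Q: "integral quadrant H = integral (cell h 0 0) H + (\<Sum>(i, j)\<in>?J. integral (cell h i j) H)
        - 4 * u x * integral (D2 L) (\<lambda>\<xi>. norm \<xi> powr (-(2 + \<alpha>)))"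
      unfolding HD2 by simp
    have disc: "disc_frac_lap \<alpha> \<gamma> L N u x = - frac_const 2 \<alpha> * (?Z + (\<Sum>(i, j)\<in>?J. ?T i j)
        - 4 * u x * integral (D2 L) (\<lambda>\<xi>. norm \<xi> powr (-(2 + \<alpha>))))"
      unfolding disc_frac_lap_def Let_def h_def[symmetric] sum_distrib_left case_prod_unfold ..
    have E0: "\<bar>integral (cell h 0 0) H - ?Z\<bar> \<le> C1 * h powr \<epsilon>"
      unfolding H_def C1_def
    proof (rule cell00_error[OF h K assms(1,6) \<epsilon>2 \<sigma>(3) assms(9,10) qd(1)])
      have "cell h 0 0 \<subseteq> quadrant" by (auto simp: mem_cell)
      then have "set_integrable lborel (cell h 0 0) H"
        by (intro set_integrable_subset[OF Hint]) (auto simp: cell_def)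
      then show "(\<lambda>\<xi>. quad_diff u x \<xi> * norm \<xi> powr (-(2 + \<alpha>))) integrable_on cell h 0 0"
        unfolding H_def by (rule set_borel_integral_eq_integral(1))
    qed
    \<comment> \<open>The powers split by \<gamma> recombine to the same kernel, also at the origin,
      where all of them are 0.\<close>
    have Hpsi: "H = (\<lambda>\<xi>. (norm \<xi> powr (-\<gamma>) * quad_diff u x \<xi>) * omega \<alpha> \<gamma> \<xi>)"
    proof
      fix \<xi> :: "real \<times> real"
      have "norm \<xi> powr (-(2 + \<alpha>)) = norm \<xi> powr (-\<gamma>) * omega \<alpha> \<gamma> \<xi>"
        unfolding omega_def by (simp flip: powr_add)
      then show "H \<xi> = (norm \<xi> powr (-\<gamma>) * quad_diff u x \<xi>) * omega \<alpha> \<gamma> \<xi>"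
        by (simp add: H_def)
    qed
    have E: "\<bar>integral (cell h i j) H - ?T i j\<bar> \<le> C2 * h powr \<epsilon> * real (max i j) powr (-(2 + \<alpha>))" if "(i, j) \<in> ?J" for i j
    proof -
      have "(i, j) \<noteq> (0, 0)" using that by simp
      then have "\<bar>integral (cell h i j) H - 1/4 * (\<Sum>m\<in>{0::nat,1}. \<Sum>n\<in>{0::nat,1}. psi \<gamma> u x (grid_pt h (i + m) (j + n)))
            * integral (cell h i j) (omega \<alpha> \<gamma>)\<bar> \<le> C2 * h powr (\<sigma> - \<alpha>) * real (max i j) powr (-(2 + \<alpha>))"
        unfolding Hpsi psi_eq_quad_diff C2_def
        using assms(1,9,10)
        by (intro cell_quadrature_error[OF h K _ _ \<sigma>(1,2) _ continuous_quad_diff[OF cont] qd[folded \<sigma>_def]]) auto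
      then show ?thesis by (simp add: \<sigma>_def mult.assoc)
    qed
    have "\<bar>(\<Sum>(i, j)\<in>?J. integral (cell h i j) H) - (\<Sum>(i, j)\<in>?J. ?T i j)\<bar>
        = \<bar>\<Sum>(i, j)\<in>?J. integral (cell h i j) H - ?T i j\<bar>"
      unfolding sum_subtractf[symmetric] case_prod_unfold ..
    also have "\<dots> \<le> (\<Sum>(i, j)\<in>?J. C2 * h powr \<epsilon> * real (max i j) powr (-(2 + \<alpha>)))"
    proof (rule order_trans[OF sum_abs sum_mono])
      show "\<bar>case z of (i, j) \<Rightarrow> integral (cell h i j) H - ?T i j\<bar>
          \<le> (case z of (i, j) \<Rightarrow> C2 * h powr \<epsilon> * real (max i j) powr (-(2 + \<alpha>)))" if "z \<in> ?J" for z
        using E[of "fst z" "snd z"] that unfolding case_prod_unfold prod.collapse by blast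
    qed
    also have "\<dots> = C2 * h powr \<epsilon> * (\<Sum>(i, j)\<in>?J. real (max i j) powr (-(2 + \<alpha>)))"
      unfolding sum_distrib_left case_prod_unfold ..
    also have "\<dots> \<le> C2 * h powr \<epsilon> * S"
      using C12 S(2) by (intro mult_left_mono) auto
    finally have ES: "\<bar>(\<Sum>(i, j)\<in>?J. integral (cell h i j) H) - (\<Sum>(i, j)\<in>?J. ?T i j)\<bar> \<le> C2 * h powr \<epsilon> * S" .
    \<comment> \<open>The tail term is identical in both expressions and cancels, leaving the origin
      cell and the remaining cells.\<close>
    have "\<bar>frac_lap \<alpha> u x - disc_frac_lap \<alpha> \<gamma> L N u x\<bar> = \<bar>frac_const 2 \<alpha>\<bar> *
        \<bar>(integral (cell h 0 0) H - ?Z) + ((\<Sum>(i, j)\<in>?J. integral (cell h i j) H) - (\<Sum>(i, j)\<in>?J. ?T i j))\<bar>"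
    proof -
      have "\<bar>- c * (A + P - X) - - c * (A' + P' - X)\<bar> = \<bar>c\<bar> * \<bar>(A - A') + (P - P')\<bar>" for c A P X A' P' :: real
      proof -
        have "- c * (A + P - X) - - c * (A' + P' - X) = - (c * ((A - A') + (P - P')))"
          by (simp add: algebra_simps)
        then show ?thesis by (simp only: abs_minus_cancel abs_mult)
      qed
      then show ?thesis unfolding lap disc Q by blast
    qed
    also have "\<dots> \<le> \<bar>frac_const 2 \<alpha>\<bar> * (C1 * h powr \<epsilon> + C2 * h powr \<epsilon> * S)"
      using E0 ES by (intro mult_left_mono order_trans[OF abs_triangle_ineq add_mono]) auto
    also have "\<dots> = (C - 1) * h powr \<epsilon>" by (simp add: C_def algebra_simps)
    also have "\<dots> \<le> C * h powr \<epsilon>" by (intro mult_right_mono) auto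
    finally show ?thesis unfolding h_def .
  qed
  show ?thesis
    using C main unfolding L_def by (intro exI[of _ C] conjI exI[of _ 1] allI impI ballI) auto
qed

end
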